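(* Let $f\colon \mathbb{T}^2\to \mathbb{T}^2$ be an irrotational homeomorphism preserving a Borel probability measure $\mu$ of full support, and let $\hat f$ be its irrotational lift. Consider the three conditions: (i) $\mathrm{Fix}(f)$ is fully essential; (ii) every point of $\mathbb{R}^2$ has a bounded $\hat f$-orbit; (iii) there is a nonzero $v\in\mathbb{Z}^2$ and $M>0$ such that $|\langle \hat f^n(z)-z; v\rangle|\le M$ for all $z\in\mathbb{R}^2$ and $n\in\mathbb{Z}$. Suppose that (i) holds and neither (ii) nor (iii) holds. Then the essential connected component of $\mathrm{Fix}(f)$ is not locally connected.
   Context: $\mathbb{T}^2=\mathbb{R}^2/\mathbb{Z}^2$; $\langle\cdot;\cdot\rangle$ is the standard inner product. For a homeomorphism $f$ of $\mathbb{T}^2$ homotopic to the identity and a lift $\hat f\colon\mathbb{R}^2\to\mathbb{R}^2$ of $f$, the rotation set $\rho(\hat f)\subset\mathbb{R}^2$ is the set of all limits $\lim_{k\to\infty}(\hat f^{n_k}(z_k)-z_k)/n_k$ with $z_k\in\mathbb{R}^2$, $n_k\in\mathbb{N}$, $n_k\to\infty$. $f$ is irrotational if it is homotopic to the identity and has a lift $\hat f$ with $\rho(\hat f)=\{(0,0)\}$; this (unique) lift is its irrotational lift. An open set $U\subset\mathbb{T}^2$ is inessential if every loop in $U$ is homotopically trivial in $\mathbb{T}^2$; an arbitrary set is inessential if it has an inessential open neighborhood, and essential otherwise; a set $E\subset\mathbb{T}^2$ is fully essential if $\mathbb{T}^2\setminus E$ is inessential. When the compact set $\mathrm{Fix}(f)$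 is fully essential, exactly one of its connected components is essential (and that component is fully essential); this is "the essential connected component". *)

theory Defs
  imports "HOL-Analysis.Analysis" "HOL-Probability.Probability"
begin

definition int_lattice :: "(real^2) set" where
  "int_lattice = {v. \<forall>i. v $ i \<in> \<int>}"

quotient_type torus = "real^2" / "\<lambda>x y. x - y \<in> int_lattice"
  morphisms rep_torus torus_proj
proof (rule equivpI)
  show "reflp (\<lambda>x y. x - y \<in> int_lattice)"
    by (simp add: reflp_def int_lattice_def)
  show "symp (\<lambda>x y. x - y \<in> int_lattice)"
  proof (rule sympI)
    fix x y :: "real^2" assume "x - y \<in> int_lattice"
    then have "- (x $ i - y $ i) \<in> \<int>" for i
      unfolding int_lattice_def by (simp only: mem_Collect_eq vector_minus_component Ints_minus)
    then show "y - x \<in> int_lattice"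
      by (simp add: int_lattice_def)
  qed
  show "transp (\<lambda>x y. x - y \<in> int_lattice)"
  proof (rule transpI)
    fix x y z :: "real^2" assume "x - y \<in> int_lattice" "y - z \<in> int_lattice"
    then have "(x $ i - y $ i) + (y $ i - z $ i) \<in> \<int>" for i
      unfolding int_lattice_def by (intro Ints_add) simp_all
    then show "x - z \<in> int_lattice"
      by (simp add: int_lattice_def)
  qed
qed

text \<open>The torus carries the quotient topology.\<close>

instantiation torus :: topological_space
begin

definition open_torus :: "torus set \<Rightarrow> bool" where
  "open_torus U \<longleftrightarrow> open (torus_proj -` U)"

instance
proof
  show "open (UNIV :: torus set)"
    by (simp add: open_torus_def)
  show "open (S \<inter> T)" if "open S" "open T" for S T :: "torus set"
    using that by (simp add: open_torus_def vimage_Int open_Int)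
  show "open (\<Union>K)" if "\<forall>S\<in>K. open S" for K :: "torus set set"
    using that by (auto simp: open_torus_def vimage_Union)
qed

end

definition lift_of :: "(torus \<Rightarrow> torus) \<Rightarrow> (real^2 \<Rightarrow> real^2) \<Rightarrow> bool" where
  "lift_of f F \<longleftrightarrow> continuous_on UNIV F \<and> (\<forall>z. torus_proj (F z) = f (torus_proj z))"

definition rotation_set :: "(real^2 \<Rightarrow> real^2) \<Rightarrow> (real^2) set" where
  "rotation_set F =
     {w. \<exists>(z :: nat \<Rightarrow> real^2) (n :: nat \<Rightarrow> nat).
           filterlim n at_top sequentially \<and>
           (\<lambda>k. ((F ^^ n k) (z k) - z k) /\<^sub>R real (n k)) \<longlonglongrightarrow> w}"

definition irrotational_lift :: "(torus \<Rightarrow> torus) \<Rightarrow> (real^2 \<Rightarrow> real^2) \<Rightarrow> bool" where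
  "irrotational_lift f F \<longleftrightarrow> lift_of f F \<and> rotation_set F = {0}"

definition irrotational :: "(torus \<Rightarrow> torus) \<Rightarrow> bool" where
  "irrotational f \<longleftrightarrow>
     homotopic_with_canon (\<lambda>_. True) UNIV UNIV f id \<and> (\<exists>F. irrotational_lift f F)"

text \<open>Integer iterates; meaningful for bijective \<open>F\<close>, in particular for every lift of a
  homeomorphism homotopic to the identity.\<close>

definition int_iterate :: "('a \<Rightarrow> 'a) \<Rightarrow> int \<Rightarrow> 'a \<Rightarrow> 'a" where
  "int_iterate F n = (if 0 \<le> n then F ^^ nat n else (inv F) ^^ nat (- n))"

definition inessential_open :: "torus set \<Rightarrow> bool" where
  "inessential_open U \<longleftrightarrow>
     (\<forall>\<gamma>. path \<gamma> \<and> pathfinish \<gamma> = pathstart \<gamma> \<and> path_image \<gamma> \<subseteq> U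
        \<longrightarrow> (\<exists>a. homotopic_loops UNIV \<gamma> (\<lambda>_. a)))"

text \<open>On open sets this agrees with \<^const>\<open>inessential_open\<close>, which is inherited by subsets.\<close>

definition inessential :: "torus set \<Rightarrow> bool" where
  "inessential E \<longleftrightarrow> (\<exists>U. open U \<and> E \<subseteq> U \<and> inessential_open U)"

abbreviation essential :: "torus set \<Rightarrow> bool" where
  "essential E \<equiv> \<not> inessential E"

definition fully_essential :: "torus set \<Rightarrow> bool" where
  "fully_essential E \<longleftrightarrow> inessential (- E)"

definition Fix :: "('a \<Rightarrow> 'a) \<Rightarrow> 'a set" where
  "Fix f = {x. f x = x}"

definition all_orbits_bounded :: "(real^2 \<Rightarrow> real^2) \<Rightarrow> bool" where
  "all_orbits_bounded F \<longleftrightarrow> (\<forall>z. bounded (range (\<lambda>n :: int. int_iterate F n z)))"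

definition bounded_in_integer_direction :: "(real^2 \<Rightarrow> real^2) \<Rightarrow> bool" where
  "bounded_in_integer_direction F \<longleftrightarrow>
     (\<exists>v \<in> int_lattice. v \<noteq> 0 \<and>
        (\<exists>M > 0. \<forall>z. \<forall>n :: int. \<bar>(int_iterate F n z - z) \<bullet> v\<bar> \<le> M))"

definition full_support :: "torus measure \<Rightarrow> bool" where
  "full_support \<mu> \<longleftrightarrow> (\<forall>U. open U \<and> U \<noteq> {} \<longrightarrow> emeasure \<mu> U > 0)"

end

theory Submission
  imports Defs "HOL-Complex_Analysis.Winding_Numbers"
begin

text \<open>Suppose the essential component \<open>C\<close> is locally connected and let \<open>E\<close> be its preimage in the
  plane. Because \<open>Fix f\<close> is fully essential, small neighbourhoods of \<open>C\<close> contain loops in two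
  independent homology directions; by local connectedness these loops can be pushed into \<open>C\<close>, so
  \<open>E\<close> contains a doubly periodic connected grid and every component of its complement is
  bounded. The lift fixes \<open>E\<close> pointwise and permutes these components. By Poincare recurrence
  each component is mapped by some iterate onto an integer translate of itself, and
  irrotationality makes this translation trivial. Hence all orbits of the lift are bounded.\<close>

subsection \<open>Lifting from the torus to the plane\<close>

text \<open>Other components of \<open>Fix f\<close> may accumulate on \<open>C\<close>, so the
  frontier of a neighbourhood of \<open>C\<close> can meet \<open>Fix f\<close>. Hence
  \<open>C\<close> is enlarged to a set \<open>K\<close> that is clopen in \<open>Fix f\<close>:
  thin neighbourhoods of \<open>K\<close> have frontiers off \<open>Fix f\<close>. An essential loop
  near \<open>C\<close> makes some component \<open>V\<close> of the lifted neighbourhood of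
  \<open>K\<close> invariant under a nonzero lattice vector. If every lattice vector preserving
  \<open>V\<close> were parallel to that one, part of the frontier of \<open>V\<close> would carry
  an essential loop off \<open>Fix f\<close>, against full essentiality. Two independent vectors
  then yield periods in both coordinate directions, and these are transferred from \<open>V\<close>
  to \<open>E\<close> at the scale where local connectedness is uniform. The lift fixes
  \<open>E\<close> because a fixed point of \<open>f\<close> whose lift moved by a nonzero lattice
  vector would create a nonzero rotation vector.\<close>

lemma torus_proj_eq_iff: "torus_proj x = torus_proj y \<longleftrightarrow> x - y \<in> int_lattice"
  by (rule torus.abs_eq_iff)

lemma torus_proj_surj: obtains x where "torus_proj x = t"
  by (metis Quotient_abs_rep[OF Quotient_torus])

lemma int_lattice_0 [simp]: "0 \<in> int_lattice"
  by (simp add: int_lattice_def)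

lemma int_lattice_diff: "v \<in> int_lattice \<Longrightarrow> w \<in> int_lattice \<Longrightarrow> v - w \<in> int_lattice"
  by (simp add: int_lattice_def)

lemma int_lattice_minus: "v \<in> int_lattice \<Longrightarrow> - v \<in> int_lattice"
  by (simp add: int_lattice_def)

lemma int_lattice_scale: "v \<in> int_lattice \<Longrightarrow> c \<in> \<int> \<Longrightarrow> c *\<^sub>R v \<in> int_lattice"
  by (simp add: int_lattice_def)

lemma torus_proj_add [simp]: "m \<in> int_lattice \<Longrightarrow> torus_proj (x + m) = torus_proj x"
  by (simp add: torus_proj_eq_iff)

lemma int_lattice_small:
  assumes "v \<in> int_lattice" "norm v < 1" shows "v = 0"
proof -
  have "v $ i = 0" for i
  proof -
    have "\<bar>v $ i\<bar> < 1" using component_le_norm_cart[of v i] assms(2) by linarith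
    then show ?thesis using assms(1) Ints_nonzero_abs_less1 by (auto simp: int_lattice_def)
  qed
  then show ?thesis by (simp add: vec_eq_iff)
qed

lemma int_lattice_reduce:
  obtains m where "m \<in> int_lattice" "(x :: real^2) + m \<in> cbox 0 1"
proof
  show "(\<chi> i. - real_of_int \<lfloor>x $ i\<rfloor>) \<in> int_lattice"
    by (simp add: int_lattice_def)
  show "x + (\<chi> i. - real_of_int \<lfloor>x $ i\<rfloor>) \<in> cbox 0 1"
    by (auto simp: mem_box_cart) linarith+
qed

lemma continuous_on_torus_proj: "continuous_on S torus_proj"
  using continuous_on_subset[of UNIV torus_proj S]
  by (simp add: continuous_on_open_vimage open_torus_def)

lemma continuous_on_from_torus:
  assumes "continuous_on UNIV (g \<circ> torus_proj)" shows "continuous_on UNIV g"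
  using assms by (simp add: continuous_on_open_vimage open_torus_def vimage_comp o_def)

lemma open_torus_proj_image:
  assumes "open S" shows "open (torus_proj ` S)"
proof -
  have "torus_proj -` (torus_proj ` S) = (\<Union>m\<in>int_lattice. (\<lambda>x. m + x) ` S)"
  proof (intro set_eqI iffI)
    fix x assume "x \<in> torus_proj -` (torus_proj ` S)"
    then obtain y where "y \<in> S" "x - y \<in> int_lattice" by (auto simp: torus_proj_eq_iff)
    then show "x \<in> (\<Union>m\<in>int_lattice. (\<lambda>x. m + x) ` S)"
      by (intro UN_I[of "x - y"] image_eqI[of _ _ y]) auto
  next
    fix x assume "x \<in> (\<Union>m\<in>int_lattice. (\<lambda>x. m + x) ` S)"
    then show "x \<in> torus_proj -` (torus_proj ` S)"
      by (force simp: torus_proj_eq_iff image_iff)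
  qed
  then show ?thesis
    using assms by (auto simp: open_torus_def intro!: open_UN open_translation)
qed

lemma torus_proj_image_cbox: "torus_proj ` cbox 0 1 = UNIV"
proof -
  have "t \<in> torus_proj ` cbox 0 1" for t
    by (metis image_eqI int_lattice_reduce torus_proj_add torus_proj_surj)
  then show ?thesis by auto
qed

lemma compact_torus: "compact (UNIV :: torus set)"
  by (metis compact_cbox compact_continuous_image continuous_on_torus_proj torus_proj_image_cbox)

text \<open>The two coordinate characters embed the torus into \<open>\<complex> \<times> \<complex>\<close>, which gives access to
  library results available only in Euclidean spaces.\<close>

lift_definition torus_char :: "2 \<Rightarrow> torus \<Rightarrow> complex" is
  "\<lambda>i x. exp (2 * of_real pi * \<i> * of_real (x $ i))"
proof -
  fix i and x y :: "real^2" assume "x - y \<in> int_lattice"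
  then obtain k where "x $ i - y $ i = of_int k"
    by (auto simp: int_lattice_def elim: Ints_cases)
  then have "x $ i = y $ i + of_int k" by simp
  then show "exp (2 * of_real pi * \<i> * of_real (x $ i)) = exp (2 * of_real pi * \<i> * of_real (y $ i))"
    unfolding exp_eq by (intro exI[of _ k]) (simp add: algebra_simps)
qed

lemma torus_char_nonzero [simp]: "torus_char i t \<noteq> 0"
  by (transfer) simp

lemma continuous_on_torus_char: "continuous_on S (torus_char i)"
proof -
  have "continuous_on UNIV (torus_char i)"
    by (rule continuous_on_from_torus) (simp add: o_def torus_char.abs_eq, intro continuous_intros)
  then show ?thesis using continuous_on_subset by blast
qed

lemma torus_char_eqI:
  assumes "\<And>i. torus_char i s = torus_char i t" shows "s = t"
proof -
  obtain x y where xy: "s = torus_proj x" "t = torus_proj y" by (metis torus_proj_surj)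
  have "x $ i - y $ i \<in> \<int>" for i
  proof -
    have "exp (2 * of_real pi * \<i> * of_real (x $ i)) = exp (2 * of_real pi * \<i> * of_real (y $ i))"
      using assms[of i] by (simp add: xy torus_char.abs_eq)
    then obtain k::int where "2 * of_real pi * \<i> * of_real (x $ i)
        = 2 * of_real pi * \<i> * of_real (y $ i) + of_int (2 * k) * of_real pi * \<i>"
      unfolding exp_eq by auto
    then have "2 * of_real pi * \<i> * of_real (x $ i - y $ i - of_int k) = 0"
      by (simp add: algebra_simps)
    then have "x $ i - y $ i - of_int k = 0" by (simp only: mult_eq_0_iff of_real_eq_0_iff) auto
    then have "x $ i - y $ i = of_int k" by simp
    then show ?thesis by (metis Ints_of_int)
  qed
  then show ?thesis by (simp add: xy torus_proj_eq_iff int_lattice_def)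
qed

text \<open>On a contractible domain each character of \<open>h\<close> has a continuous logarithm.
  Characters have modulus one, so the logarithms are purely imaginary, and dividing by
  \<open>2 * pi\<close> gives the coordinates of the lift.\<close>

lemma torus_lift_exists:
  fixes h :: "'a::real_normed_vector \<Rightarrow> torus"
  assumes "continuous_on S h" "contractible S"
  obtains H where "continuous_on S H" "\<And>x. x \<in> S \<Longrightarrow> torus_proj (H x) = h x"
proof -
  have "\<exists>g. continuous_on S g \<and> (\<forall>x\<in>S. torus_char i (h x) = exp (g x))" for i
  proof -
    have "continuous_on S (\<lambda>x. torus_char i (h x))"
      using continuous_on_compose[OF assms(1) continuous_on_torus_char] by (simp add: o_def)
    then show ?thesis
      using continuous_logarithm_on_contractible[of S "\<lambda>x. torus_char i (h x)"] assms(2)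
      by (metis torus_char_nonzero)
  qed
  then obtain g where g: "\<And>i. continuous_on S (g i)"
    "\<And>i x. x \<in> S \<Longrightarrow> torus_char i (h x) = exp (g i x)" by metis
  have norm1: "cmod (torus_char i t) = 1" for i t
  proof -
    obtain x where "t = torus_proj x" by (metis torus_proj_surj)
    then show ?thesis by (simp add: torus_char.abs_eq norm_exp_i_times mult.commute mult.left_commute flip: of_real_mult)
  qed
  define H where "H x = (\<chi> i. Im (g i x) / (2 * pi))" for x
  show ?thesis
  proof
    show "continuous_on S H"
      unfolding H_def by (intro continuous_on_vec_lambda continuous_intros g) auto
    fix x assume x: "x \<in> S"
    show "torus_proj (H x) = h x"
    proof (rule torus_char_eqI)
      fix i
      have "Re (g i x) = 0" using g(2)[OF x, of i] norm1[of i "h x"] by (simp add: norm_exp_eq_Re)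
      then have "g i x = \<i> * of_real (Im (g i x))" by (simp add: complex_eq_iff)
      then have "g i x = 2 * of_real pi * \<i> * of_real (H x $ i)" by (simp add: H_def)
      then show "torus_char i (torus_proj (H x)) = torus_char i (h x)"
        using g(2)[OF x, of i] by (simp add: torus_char.abs_eq)
    qed
  qed
qed

text \<open>The i-th coordinate of the displacement is the winding number about 0 of the i-th
  character along the projected loop, hence a homotopy invariant.\<close>

lemma homotopic_torus_loops_displacement:
  assumes "homotopic_loops UNIV (torus_proj \<circ> \<gamma>) (torus_proj \<circ> \<eta>)" "path \<gamma>" "path \<eta>"
  shows "pathfinish \<gamma> - pathstart \<gamma> = pathfinish \<eta> - pathstart \<eta>"
proof -
  have "(pathfinish \<gamma> - pathstart \<gamma>) $ i = (pathfinish \<eta> - pathstart \<eta>) $ i" for i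
  proof -
    have wn: "winding_number (torus_char i \<circ> (torus_proj \<circ> \<gamma>)) 0 = of_real ((pathfinish \<gamma> - pathstart \<gamma>) $ i)"
      if "path \<gamma>" for \<gamma>
    proof -
      let ?p = "\<lambda>t. 2 * of_real pi * \<i> * of_real (\<gamma> t $ i) :: complex"
      have "path ?p"
        using that unfolding path_def by (intro continuous_intros)
      moreover have "torus_char i \<circ> (torus_proj \<circ> \<gamma>) = exp \<circ> ?p"
        by (simp add: o_def torus_char.abs_eq)
      ultimately show ?thesis
        using winding_number_compose_exp[of ?p]
        by (simp add: pathfinish_def pathstart_def diff_divide_distrib)
    qed
    have "homotopic_loops (- {0}) (torus_char i \<circ> (torus_proj \<circ> \<gamma>)) (torus_char i \<circ> (torus_proj \<circ> \<eta>))"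
      by (rule homotopic_loops_continuous_image[OF assms(1) continuous_on_torus_char]) auto
    from winding_number_homotopic_loops[OF this] show ?thesis
      unfolding wn[OF assms(2)] wn[OF assms(3)] by (simp only: of_real_eq_iff)
  qed
  then show ?thesis by (simp add: vec_eq_iff)
qed

text \<open>This and the next lemma translate inessentiality into the plane: an open set is
  inessential exactly when the lifts of its loops close up.\<close>

lemma inessential_open_lift:
  assumes "inessential_open U" "path \<gamma>" "\<And>t. t \<in> {0..1} \<Longrightarrow> torus_proj (\<gamma> t) \<in> U"
    "pathfinish \<gamma> - pathstart \<gamma> \<in> int_lattice"
  shows "pathfinish \<gamma> = pathstart \<gamma>"
proof -
  have "path (torus_proj \<circ> \<gamma>)"
    using assms(2) continuous_on_torus_proj by (rule path_continuous_image)
  moreover have "pathfinish (torus_proj \<circ> \<gamma>) = pathstart (torus_proj \<circ> \<gamma>)"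
    using assms(4) by (simp add: pathfinish_compose pathstart_compose torus_proj_eq_iff)
  moreover have "path_image (torus_proj \<circ> \<gamma>) \<subseteq> U"
    using assms(3) by (auto simp: path_image_def)
  ultimately obtain a where a: "homotopic_loops UNIV (torus_proj \<circ> \<gamma>) (\<lambda>_. a)"
    using assms(1) unfolding inessential_open_def by blast
  obtain x where "torus_proj x = a" by (rule torus_proj_surj)
  then have "homotopic_loops UNIV (torus_proj \<circ> \<gamma>) (torus_proj \<circ> (\<lambda>_. x))"
    using a by (simp add: o_def)
  moreover have "path (\<lambda>_::real. x)" by (simp add: path_def)
  ultimately have "pathfinish \<gamma> - pathstart \<gamma> = pathfinish (\<lambda>_. x) - pathstart (\<lambda>_. x)"
    using homotopic_torus_loops_displacement assms(2) by blast
  then show ?thesis by (simp add: pathfinish_def pathstart_def)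
qed

text \<open>Were the lift of a loop closed, it would contract linearly in the plane, and projecting
  the contraction would make the loop trivial.\<close>

lemma not_inessential_openE:
  assumes "\<not> inessential_open U"
  obtains \<gamma> where "path \<gamma>" "\<And>t. t \<in> {0..1} \<Longrightarrow> torus_proj (\<gamma> t) \<in> U"
    "pathfinish \<gamma> - pathstart \<gamma> \<in> int_lattice" "pathfinish \<gamma> \<noteq> pathstart \<gamma>"
proof -
  obtain \<delta> where \<delta>: "path \<delta>" "pathfinish \<delta> = pathstart \<delta>" "path_image \<delta> \<subseteq> U"
    and nh: "\<And>a. \<not> homotopic_loops UNIV \<delta> (\<lambda>_. a)"
    using assms unfolding inessential_open_def by blast
  obtain \<gamma> where \<gamma>: "continuous_on {0..1} \<gamma>" "\<And>t. t \<in> {0..1} \<Longrightarrow> torus_proj (\<gamma> t) = \<delta> t"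
    using torus_lift_exists[of "{0..1}" \<delta>] \<delta>(1)
    by (metis path_def convex_imp_contractible convex_real_interval(5))
  have p: "path \<gamma>" using \<gamma>(1) by (simp add: path_def)
  show ?thesis
  proof (rule that[OF p])
    show "torus_proj (\<gamma> t) \<in> U" if "t \<in> {0..1}" for t
      using \<gamma>(2)[OF that] \<delta>(3) that by (auto simp: path_image_def)
    show "pathfinish \<gamma> - pathstart \<gamma> \<in> int_lattice"
      using \<gamma>(2)[of 0] \<gamma>(2)[of 1] \<delta>(2) by (simp add: pathfinish_def pathstart_def flip: torus_proj_eq_iff)
    show "pathfinish \<gamma> \<noteq> pathstart \<gamma>"
    proof
      assume "pathfinish \<gamma> = pathstart \<gamma>"
      then have "homotopic_loops UNIV \<gamma> (\<lambda>_. 0)"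
        by (intro homotopic_loops_linear p) (auto simp: path_def pathfinish_def pathstart_def)
      then have "homotopic_loops UNIV (torus_proj \<circ> \<gamma>) (torus_proj \<circ> (\<lambda>_. 0))"
        by (rule homotopic_loops_continuous_image[OF _ continuous_on_torus_proj]) auto
      moreover have "homotopic_loops UNIV \<delta> (torus_proj \<circ> \<gamma>)"
        using \<delta> \<gamma>(2) by (intro homotopic_loops_eq) auto
      ultimately have "homotopic_loops UNIV \<delta> (\<lambda>_. torus_proj 0)"
        using homotopic_loops_trans by (fastforce simp: o_def)
      then show False using nh by blast
    qed
  qed
qed

subsection \<open>Periodic sets in the plane\<close>

lemma connected_translate:
  fixes S :: "'a::real_normed_vector set"
  shows "connected S \<Longrightarrow> connected ((\<lambda>x. m + x) ` S)"
  by (intro connected_continuous_image continuous_intros)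

text \<open>The Fashoda theorem wants both paths inside a box with ends on its sides, but here each
  path is confined in one coordinate only and may overshoot in the other. Clamping by
  \<open>\<kappa>\<close> restores its hypotheses.\<close>

lemma crossing_paths_meet_aux:
  fixes g h :: "real \<Rightarrow> real^2"
  assumes g: "path g" "pathstart g $ 1 \<le> a" "b \<le> pathfinish g $ 1"
    and h: "path h" "pathstart h $ 2 \<le> c" "d \<le> pathfinish h $ 2"
    and g_in: "\<And>z. z \<in> path_image g \<Longrightarrow> c < z $ 2 \<and> z $ 2 < d"
    and h_in: "\<And>z. z \<in> path_image h \<Longrightarrow> a < z $ 1 \<and> z $ 1 < b"
  shows "path_image g \<inter> path_image h \<noteq> {}"
proof -
  define l u where "l = (vector [a, c] :: real^2)" and "u = (vector [b, d] :: real^2)"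
  define \<kappa> where "\<kappa> z = (\<chi> i. max (l $ i) (min (u $ i) (z $ i)))" for z :: "real^2"
  have ab: "a < b" "c < d"
    using h_in[OF pathstart_in_path_image] g_in[OF pathstart_in_path_image] by linarith+
  have lu: "l $ 1 = a" "l $ 2 = c" "u $ 1 = b" "u $ 2 = d" by (simp_all add: l_def u_def)
  have cont: "continuous_on S \<kappa>" for S
    unfolding \<kappa>_def by (intro continuous_on_vec_lambda continuous_intros)
  have \<kappa>_in: "\<kappa> z \<in> cbox l u" for z
    using ab by (auto simp: \<kappa>_def mem_box_cart forall_2 lu)
  have p: "path (\<kappa> \<circ> g)" "path (\<kappa> \<circ> h)"
    using g(1) h(1) cont by (auto intro: path_continuous_image)
  have c: "path_image (\<kappa> \<circ> g) \<subseteq> cbox l u" "path_image (\<kappa> \<circ> h) \<subseteq> cbox l u"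
    using \<kappa>_in by (auto simp: path_image_def)
  have e: "pathstart (\<kappa> \<circ> g) $ 1 = l $ 1" "pathfinish (\<kappa> \<circ> g) $ 1 = u $ 1"
    "pathstart (\<kappa> \<circ> h) $ 2 = l $ 2" "pathfinish (\<kappa> \<circ> h) $ 2 = u $ 2"
    using g(2,3) h(2,3) ab by (auto simp: pathstart_compose pathfinish_compose \<kappa>_def lu)
  obtain z where z: "z \<in> path_image (\<kappa> \<circ> g)" "z \<in> path_image (\<kappa> \<circ> h)"
    using fashoda[OF p c e] by blast
  obtain x y where xy: "x \<in> path_image g" "z = \<kappa> x" "y \<in> path_image h" "z = \<kappa> y"
    using z by (auto simp: path_image_compose)
  have "\<kappa> x $ 2 = x $ 2" "\<kappa> y $ 1 = y $ 1"
    using g_in[OF xy(1)] h_in[OF xy(3)] by (auto simp: \<kappa>_def lu)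
  then have z12: "z $ 2 = x $ 2" "z $ 1 = y $ 1" using xy by auto
  text \<open>Clamping alters only points on the boundary of the box, and \<open>z\<close> lies in its interior.\<close>
  have "x $ 1 = z $ 1" "y $ 2 = z $ 2"
    using z12 xy(2,4) g_in[OF xy(1)] h_in[OF xy(3)]
    by (auto simp: \<kappa>_def lu vec_eq_iff forall_2 min_def max_def split: if_splits)
  then have "x = y" using z12 by (simp add: vec_eq_iff forall_2)
  then show ?thesis using xy by auto
qed

lemma crossing_paths_meet:
  fixes g h :: "real \<Rightarrow> real^2" and i j :: 2
  assumes "i \<noteq> j" "path g" "pathstart g $ i \<le> a" "b \<le> pathfinish g $ i"
    and "path h" "pathstart h $ j \<le> c" "d \<le> pathfinish h $ j"
    and "\<And>z. z \<in> path_image g \<Longrightarrow> c < z $ j \<and> z $ j < d"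
    and "\<And>z. z \<in> path_image h \<Longrightarrow> a < z $ i \<and> z $ i < b"
  shows "path_image g \<inter> path_image h \<noteq> {}"
proof -
  consider "i = 1" "j = 2" | "i = 2" "j = 1" using assms(1) exhaust_2 by metis
  then show ?thesis
  proof cases
    case 1 then show ?thesis using crossing_paths_meet_aux[of g a b h c d] assms by blast
  next
    case 2 then show ?thesis using crossing_paths_meet_aux[of h c d g a b] assms by blast
  qed
qed

section \<open>Periodic sets with bounded complementary components\<close>

definition lattice_periodic :: "(real^2) set \<Rightarrow> bool" where
  "lattice_periodic E \<longleftrightarrow> (\<forall>m\<in>int_lattice. \<forall>z\<in>E. z + m \<in> E)"

lemma lattice_periodicD: "lattice_periodic E \<Longrightarrow> m \<in> int_lattice \<Longrightarrow> z \<in> E \<Longrightarrow> z + m \<in> E"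
  by (auto simp: lattice_periodic_def)

lemma lattice_periodic_vimage: "lattice_periodic (torus_proj -` A)"
  by (auto simp: lattice_periodic_def)

text \<open>The witness is merely connected because local connectedness supplies no paths directly;
  its boundedness confines its translates to a strip.\<close>

definition joined :: "(real^2) set \<Rightarrow> real^2 \<Rightarrow> real^2 \<Rightarrow> bool" where
  "joined E x y \<longleftrightarrow> (\<exists>S. connected S \<and> bounded S \<and> S \<subseteq> E \<and> x \<in> S \<and> y \<in> S)"

lemma joined_refl: "x \<in> E \<Longrightarrow> joined E x x"
  unfolding joined_def by (intro exI[of _ "{x}"]) auto

lemma joined_sym: "joined E x y \<Longrightarrow> joined E y x"
  unfolding joined_def by blast

lemma joined_trans:
  assumes "joined E x y" "joined E y z" shows "joined E x z"
proof -
  obtain S T where "connected S" "bounded S" "S \<subseteq> E" "x \<in> S" "y \<in> S"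
    "connected T" "bounded T" "T \<subseteq> E" "y \<in> T" "z \<in> T"
    using assms unfolding joined_def by blast
  then show ?thesis unfolding joined_def
    by (intro exI[of _ "S \<union> T"]) (auto intro: connected_Un)
qed

lemma joined_in: "joined E x y \<Longrightarrow> x \<in> E \<and> y \<in> E"
  unfolding joined_def by blast

lemma joined_translate:
  assumes "joined E x y" "lattice_periodic E" "m \<in> int_lattice"
  shows "joined E (x + m) (y + m)"
proof -
  obtain S where S: "connected S" "bounded S" "S \<subseteq> E" "x \<in> S" "y \<in> S"
    using assms(1) unfolding joined_def by blast
  show ?thesis unfolding joined_def
  proof (intro exI[of _ "(\<lambda>z. m + z) ` S"] conjI)
    show "connected ((\<lambda>z. m + z) ` S)" by (rule connected_translate[OF S(1)])
    show "bounded ((\<lambda>z. m + z) ` S)" by (simp add: S bounded_translation)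
    show "(\<lambda>z. m + z) ` S \<subseteq> E"
      using S(3) lattice_periodicD[OF assms(2,3)] by (auto simp: add.commute)
  qed (use S in \<open>auto simp: add.commute\<close>)
qed

text \<open>Translates of the witness joining \<open>p\<close> to \<open>p + axis j N\<close> chain
  up to a long bar in direction \<open>j\<close>, contained in \<open>E\<close> and of bounded width
  in direction \<open>i\<close>. A path in \<open>D\<close> that travels too far in direction
  \<open>i\<close> would have to cross such a bar.\<close>

lemma component_coordinate_spread:
  fixes E D :: "(real^2) set" and i j :: 2
  assumes "i \<noteq> j" "closed E" and per: "lattice_periodic E"
    and N: "N \<in> \<int>" "N > 0" and jo: "joined E p (p + axis j N)"
    and D: "D \<in> components (- E)"
  shows "\<exists>B. \<forall>z\<in>D. \<forall>z'\<in>D. z' $ i - z $ i \<le> B"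
proof -
  obtain S where S: "connected S" "bounded S" "S \<subseteq> E" "p \<in> S" "p + axis j N \<in> S"
    using jo unfolding joined_def by blast
  obtain r where r: "\<And>x. x \<in> S \<Longrightarrow> norm x \<le> r" using S(2) by (auto simp: bounded_iff)
  define R where "R = 2 * r + 1"
  have R: "\<bar>x $ i - p $ i\<bar> < R" if "x \<in> S" for x
    using component_le_norm_cart[of x i] component_le_norm_cart[of p i] r[OF that] r[OF S(4)]
    unfolding R_def by linarith
  have "z' $ i - z $ i \<le> 2 * R + 2" if zz: "z \<in> D" "z' \<in> D" for z z'
  proof (rule ccontr)
    assume "\<not> ?thesis"
    then have far: "z' $ i - z $ i > 2 * R + 2" by simp
    have "open D" using D \<open>closed E\<close> open_components by blast
    moreover have "connected D" using D in_components_connected by blast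
    ultimately have "path_connected D" using connected_open_path_connected by blast
    then obtain g where g: "path g" "path_image g \<subseteq> D" "pathstart g = z" "pathfinish g = z'"
      using zz unfolding path_connected_def by blast
    have disj: "path_image g \<inter> E = {}" using g(2) D in_components_subset by blast
    obtain \<eta> where \<eta>: "\<eta> > 0" "\<And>x e. x \<in> path_image g \<Longrightarrow> e \<in> E \<Longrightarrow> \<eta> \<le> dist x e"
      using separate_compact_closed[OF compact_path_image[OF g(1)] \<open>closed E\<close> disj] by blast
    obtain Y where "Y > 0" and Y: "\<And>x. x \<in> path_image g \<Longrightarrow> norm x < Y"
      using compact_imp_bounded[OF compact_path_image[OF g(1)]] bounded_pos_less[of "path_image g"] by blast
    \<comment> \<open>Places the bar strictly between \<open>z\<close> and \<open>z'\<close> in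
      coordinate \<open>i\<close>. Its width is below \<open>2 * R\<close> and the ceiling costs
      less than 1.\<close>
    define k where "k = \<lceil>z $ i - p $ i + R\<rceil>"
    \<comment> \<open>The bar is only connected, so it is thickened to an open set, where connected
      points are joined by paths. The thickening misses \<open>g\<close> because
      \<open>\<eta>\<close> separates \<open>g\<close> from \<open>E\<close>.\<close>
    define W where "W = (\<Union>e\<in>E. ball e \<eta>) \<inter> {x. z $ i < x $ i \<and> x $ i < z' $ i}"
    have "open W" unfolding W_def
      by (intro open_Int open_UN ballI open_ball open_Collect_conj open_Collect_less continuous_intros)
    define P where "P (n::int) = p + axis i (of_int k) + axis j (of_int n * N)" for n
    have lat: "axis i (of_int k) + axis j (of_int n * N) \<in> int_lattice" for n
      using N(1) by (auto simp: int_lattice_def axis_def)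
    have step: "connected_component W (P n) (P (n + 1))" for n
      unfolding connected_component_def
    proof (intro exI conjI)
      let ?m = "axis i (of_int k) + axis j (of_int n * N)"
      show "connected ((\<lambda>x. ?m + x) ` S)" by (rule connected_translate[OF S(1)])
      show "P n \<in> (\<lambda>x. ?m + x) ` S" 
        by (rule image_eqI[OF _ S(4)]) (simp add: P_def ac_simps)
      have "P (n+1) = ?m + (p + axis j N)"
        by (simp add: P_def vec_eq_iff axis_def algebra_simps)
      then show "P (n+1) \<in> (\<lambda>x. ?m + x) ` S" using S(5) by blast
      have "?m + x \<in> W" if "x \<in> S" for x
      proof -
        have "?m + x \<in> E"
          using lattice_periodicD[OF per lat[of n]] S(3) that by (metis add.commute subsetD)
        then have "?m + x \<in> (\<Union>e\<in>E. ball e \<eta>)" using \<eta>(1) by (intro UN_I) auto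
        moreover have "(?m + x) $ i = x $ i + of_int k"
          using \<open>i \<noteq> j\<close> by (simp add: axis_def)
        moreover have "z $ i < x $ i + of_int k" "x $ i + of_int k < z' $ i"
          using R[OF that] far unfolding k_def by linarith+
        ultimately show ?thesis unfolding W_def by simp
      qed
      then show "(\<lambda>x. ?m + x) ` S \<subseteq> W" by blast
    qed
    have chain: "connected_component W (P n) (P (n + int l))" for n l
    proof (induction l)
      case 0
      show ?case using step[of n] by (metis add.right_neutral connected_component_in connected_component_refl int_ops(1))
    next
      case (Suc l)
      show ?case using connected_component_trans[OF Suc step[of "n + int l"]] by (simp add: ac_simps)
    qed
    \<comment> \<open>Since \<open>N \<ge> 1\<close>, this many copies of the witness on either side
      reach beyond the height \<open>Y\<close> of \<open>g\<close>.\<close>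
    define J where "J = nat \<lceil>Y + \<bar>p $ j\<bar>\<rceil>"
    have J: "real J \<ge> Y + \<bar>p $ j\<bar>" unfolding J_def by linarith
    have N1: "N \<ge> 1" using N by (auto elim!: Ints_cases)
    have JN: "real J * N \<ge> Y + \<bar>p $ j\<bar>"
      using J N1 mult_left_mono[of 1 N "real J"] by linarith
    have "path_component W (P (- int J)) (P (int J))"
      using chain[of "- int J" "2 * J"] open_path_connected_component[OF \<open>open W\<close>] by simp
    then obtain h where h: "path h" "path_image h \<subseteq> W" "pathstart h = P (- int J)" "pathfinish h = P (int J)"
      unfolding path_component_def by blast
    have "path_image g \<inter> path_image h \<noteq> {}"
    proof (rule crossing_paths_meet[OF \<open>i \<noteq> j\<close> g(1) _ _ h(1)])
      show "pathstart g $ i \<le> z $ i" "z' $ i \<le> pathfinish g $ i" using g by auto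
      show "pathstart h $ j \<le> - Y" "Y \<le> pathfinish h $ j"
        using JN \<open>i \<noteq> j\<close> unfolding h P_def by (auto simp: axis_def)
      show "- Y < x $ j \<and> x $ j < Y" if "x \<in> path_image g" for x
        using Y[OF that] component_le_norm_cart[of x j] by (auto simp: abs_le_iff)
      show "z $ i < x $ i \<and> x $ i < z' $ i" if "x \<in> path_image h" for x
        using h(2) that unfolding W_def by blast
    qed
    then obtain x where "x \<in> path_image g" "x \<in> W" using h(2) by blast
    then show False using \<eta>(2) unfolding W_def by (force simp: dist_commute)
  qed
  then show ?thesis by blast
qed

lemma bounded_component_of_grid_complement:
  fixes E D :: "(real^2) set"
  assumes "closed E" "lattice_periodic E" "N \<in> \<int>" "N > 0"
    and jo: "\<And>j. joined E p (p + axis j N)" and D: "D \<in> components (- E)"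
  shows "bounded D"
proof -
  have "\<exists>B. \<forall>z\<in>D. \<forall>z'\<in>D. z' $ i - z $ i \<le> B" for i
  proof -
    obtain j :: 2 where "i \<noteq> j"
    proof (cases "i = 1")
      case True then show ?thesis by (intro that[of 2]) simp
    next
      case False then show ?thesis by (rule that)
    qed
    then show ?thesis using component_coordinate_spread assms by blast
  qed
  then obtain B where B: "\<And>i z z'. z \<in> D \<Longrightarrow> z' \<in> D \<Longrightarrow> z' $ i - z $ i \<le> B i" by metis
  obtain z0 where z0: "z0 \<in> D" using D in_components_nonempty by blast
  have "D \<subseteq> cbox (\<chi> i. z0 $ i - B i) (\<chi> i. z0 $ i + B i)"
  proof
    fix z assume "z \<in> D"
    then show "z \<in> cbox (\<chi> i. z0 $ i - B i) (\<chi> i. z0 $ i + B i)"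
      using B[OF z0, of z] B[OF _ z0, of z] by (auto simp: mem_box_cart algebra_simps)
  qed
  then show ?thesis using bounded_cbox bounded_subset by blast
qed

text \<open>Two points of \<open>E\<close> within \<open>\<delta>/2\<close> of a common point are
  less than \<open>\<delta>\<close> apart, hence joined. So the class of the points of
  \<open>E\<close> near a moving point of \<open>W\<close> is locally constant, and \<open>W\<close>
  is connected.\<close>

lemma joined_if_near_connected:
  assumes loc: "\<And>x y. x \<in> E \<Longrightarrow> y \<in> E \<Longrightarrow> dist x y < \<delta> \<Longrightarrow> joined E x y"
    and W: "connected W" "W \<subseteq> (\<Union>e\<in>E. ball e (\<delta>/2))" "x \<in> W" "y \<in> W"
    and e: "e \<in> E" "dist e x < \<delta>/2" "e' \<in> E" "dist e' y < \<delta>/2"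
  shows "joined E e e'"
proof -
  \<comment> \<open>Quantifying over all nearby points makes \<open>R\<close> symmetric;
    transitivity needs some point of \<open>E\<close> near the middle point, which the cover of
    \<open>W\<close> provides.\<close>
  define R where "R z z' \<longleftrightarrow> (\<forall>e\<in>E. \<forall>e'\<in>E. dist e z < \<delta>/2 \<longrightarrow> dist e' z' < \<delta>/2 \<longrightarrow> joined E e e')" for z z'
  have "R x y"
  proof (rule connected_equivalence_relation[OF W(1,3,4), of R])
    show "R z' z" if "R z z'" for z z'
      using that joined_sym unfolding R_def by blast
    show "R u w" if "R u v" "R v w" "v \<in> W" for u v w
    proof -
      obtain c where "c \<in> E" "dist c v < \<delta>/2" using W(2) \<open>v \<in> W\<close> by auto
      then show ?thesis using that(1,2) joined_trans unfolding R_def by blast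
    qed
    fix a assume a: "a \<in> W"
    then obtain c where c: "c \<in> E" "dist c a < \<delta>/2" using W(2) by auto
    show "\<exists>T. openin (top_of_set W) T \<and> a \<in> T \<and> (\<forall>x\<in>T. R a x)"
    proof (intro exI[of _ "W \<inter> ball c (\<delta>/2)"] conjI ballI)
      fix x assume x: "x \<in> W \<inter> ball c (\<delta>/2)"
      show "R a x" unfolding R_def
      proof (intro ballI impI)
        fix e e' assume e: "e \<in> E" "e' \<in> E" "dist e a < \<delta>/2" "dist e' x < \<delta>/2"
        have "dist e c < \<delta>" "dist c e' < \<delta>"
          using dist_triangle_half_r[of a e \<delta> c] dist_triangle_half_r[of x c \<delta> e'] e c x
          by (auto simp: dist_commute)
        then show "joined E e e'" using loc e c joined_trans by meson
      qed
    qed (use a c in auto)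
  qed
  then show ?thesis using e unfolding R_def by blast
qed

text \<open>The lattice vectors realised by a witness starting at \<open>q\<close> form a group:
  witnesses can be translated, concatenated and reversed.\<close>

lemma joined_translates_group:
  assumes per: "lattice_periodic E"
  shows "v \<in> int_lattice \<Longrightarrow> joined E q (q + v) \<Longrightarrow> joined E q (q + w) \<Longrightarrow> joined E q (q + (v + w))"
    and "v \<in> int_lattice \<Longrightarrow> joined E q (q + v) \<Longrightarrow> joined E q (q + - v)"
proof -
  show "joined E q (q + (v + w))" if "v \<in> int_lattice" "joined E q (q + v)" "joined E q (q + w)"
    using joined_trans[OF that(2)] joined_translate[OF that(3) per that(1)] by (simp add: ac_simps)
  show "joined E q (q + - v)" if "v \<in> int_lattice" "joined E q (q + v)"
    using joined_translate[OF that(2) per int_lattice_minus[OF that(1)]] joined_sym by simp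
qed

lemma joined_translates_multiple:
  assumes per: "lattice_periodic E" and v: "v \<in> int_lattice" "joined E q (q + v)" and "c \<in> \<int>"
  shows "joined E q (q + c *\<^sub>R v)"
proof -
  have nat: "joined E q (q + real n *\<^sub>R v)" for n
  proof (induction n)
    case 0 show ?case using joined_refl joined_in[OF v(2)] by simp
  next
    case (Suc n)
    then show ?case using joined_translates_group(1)[OF per v Suc] by (simp add: algebra_simps)
  qed
  obtain k where "c = of_int k" using \<open>c \<in> \<int>\<close> Ints_cases by blast
  then consider n where "c = real n" | n where "c = - real n"
    by (metis int_cases2 of_int_minus of_int_of_nat_eq)
  then show ?thesis
  proof cases
    case 1 then show ?thesis using nat by simp
  next
    case (2 n)
    show ?thesis
      using joined_translates_group(2)[OF per _ nat[of n]] int_lattice_scale[OF v(1), of "real n"] 2 by simp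
  qed
qed

text \<open>The determinant with columns \<open>v\<close> and \<open>w\<close>. It tests
  independence, and for fixed \<open>v\<close> it measures the signed distance from the line spanned
  by \<open>v\<close>, scaled by \<open>norm v\<close>.\<close>

definition cross2 :: "real^2 \<Rightarrow> real^2 \<Rightarrow> real" where
  "cross2 v w = v $ 1 * w $ 2 - v $ 2 * w $ 1"

text \<open>Cramer's rule: the determinant times a basis vector is an integer combination of
  \<open>v\<close> and \<open>w\<close>. The sign \<open>s\<close> makes the resulting period
  positive.\<close>

lemma joined_axis_translates:
  assumes per: "lattice_periodic E" and v: "v \<in> int_lattice" "joined E q (q + v)"
    and w: "w \<in> int_lattice" "joined E q (q + w)" and ind: "cross2 v w \<noteq> 0"
  shows "joined E q (q + axis j \<bar>cross2 v w\<bar>)"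
proof -
  have comp: "v $ i \<in> \<int>" "w $ i \<in> \<int>" for i using v w by (auto simp: int_lattice_def)
  have comb: "joined E q (q + (a *\<^sub>R v + b *\<^sub>R w))" if "a \<in> \<int>" "b \<in> \<int>" for a b
    using that v w by (intro joined_translates_group joined_translates_multiple int_lattice_scale per)
  define d where "d = cross2 v w"
  have d: "d \<in> \<int>" using comp by (auto simp: d_def cross2_def)
  define s where "s = sgn d"
  have s: "s \<in> \<int>" "s * d = \<bar>d\<bar>" by (auto simp: s_def sgn_if)
  consider "j = 1" | "j = 2" using exhaust_2 by blast
  then show ?thesis
  proof cases
    case 1
    have "axis j \<bar>d\<bar> = (s * w $ 2) *\<^sub>R v + (- s * v $ 2) *\<^sub>R w"
      using 1 by (simp add: vec_eq_iff forall_2 axis_def flip: s(2)) (simp add: d_def cross2_def algebra_simps)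
    then show ?thesis using comb[of "s * w $ 2" "- s * v $ 2"] s comp by (simp add: d_def)
  next
    case 2
    have "axis j \<bar>d\<bar> = (- s * w $ 1) *\<^sub>R v + (s * v $ 1) *\<^sub>R w"
      using 2 by (simp add: vec_eq_iff forall_2 axis_def flip: s(2)) (simp add: d_def cross2_def algebra_simps)
    then show ?thesis using comb[of "- s * w $ 1" "s * v $ 1"] s comp by (simp add: d_def)
  qed
qed

section \<open>Lattice vectors preserving a component of a neighbourhood\<close>

lemma component_translate_subset:
  fixes S V :: "'a::real_normed_vector set"
  assumes V: "V \<in> components S" and S: "\<And>z. z \<in> V \<Longrightarrow> w + z \<in> S" and x: "x \<in> V" "w + x \<in> V" and z: "z \<in> V"
  shows "w + z \<in> V"
proof -
  have "connected ((\<lambda>z. w + z) ` V)"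
    using V in_components_connected connected_translate by blast
  moreover have "V \<inter> (\<lambda>z. w + z) ` V \<noteq> {}" using x by blast
  moreover have "(\<lambda>z. w + z) ` V \<subseteq> S" using S by blast
  ultimately have "(\<lambda>z. w + z) ` V \<subseteq> V" using components_maximal[OF V] by blast
  then show ?thesis using z by blast
qed

lemma cross2_diff: "cross2 v (x - y) = cross2 v x - cross2 v y"
  and cross2_add: "cross2 v (x + y) = cross2 v x + cross2 v y"
  and cross2_self [simp]: "cross2 v v = 0"
  by (simp_all add: cross2_def algebra_simps)

lemma cross2_le: "cross2 v x \<le> 2 * norm v * norm x"
proof -
  have "\<bar>v $ 1 * x $ 2\<bar> \<le> norm v * norm x" "\<bar>v $ 2 * x $ 1\<bar> \<le> norm v * norm x"
    unfolding abs_mult by (intro mult_mono component_le_norm_cart abs_ge_zero norm_ge_zero)+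
  then show ?thesis unfolding cross2_def by linarith
qed

lemma convex_cross2_gt: "convex {x. cross2 v x > M}"
proof -
  have "{x. cross2 v x > M} = {x. (\<chi> i. if i = 1 then - v $ 2 else v $ 1) \<bullet> x > M}"
    by (auto simp: cross2_def inner_vec_def sum_2)
  then show ?thesis by (simp add: convex_halfspace_gt)
qed

text \<open>Modulo the lattice, \<open>V\<close> is covered by finitely many small balls, and two centres falling into
  the same ball differ, up to a small error, by a translation preserving \<open>V\<close>.\<close>

lemma strip_component_bounded_above:
  fixes K V :: "(real^2) set"
  assumes per: "lattice_periodic K" and "\<eta> > 0"
    and V: "V \<in> components (\<Union>k\<in>K. ball k \<eta>)"
    and par: "\<And>x w. w \<in> int_lattice \<Longrightarrow> x \<in> V \<Longrightarrow> x + w \<in> V \<Longrightarrow> cross2 v w = 0"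
  shows "bdd_above (cross2 v ` V)"
proof -
  obtain A where "finite A" and A: "cbox 0 1 \<subseteq> (\<Union>a\<in>A. ball (a :: real^2) (\<eta>/2))"
    using compact_eq_totally_bounded[of "cbox 0 1 :: (real^2) set"] compact_cbox \<open>\<eta> > 0\<close>
    by (meson half_gt_zero)
  define P where "P a = {k \<in> K \<inter> V. \<exists>m\<in>int_lattice. k + m \<in> ball a (\<eta>/2)}" for a
  have ball_V: "ball k \<eta> \<subseteq> V" if "k \<in> K" "y \<in> V" "y \<in> ball k \<eta>" for k y
    using that by (intro components_maximal[OF V]) auto
  have "bdd_above (cross2 v ` P a)" for a
  proof (cases "P a = {}")
    case False
    then obtain k' m' where k': "k' \<in> K" "k' \<in> V" "m' \<in> int_lattice" "dist a (k' + m') < \<eta>/2"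
      unfolding P_def by auto
    have "cross2 v k \<le> cross2 v k' + 2 * norm v * \<eta>" if kP: "k \<in> P a" for k
    proof -
      obtain m where k: "k \<in> K" "k \<in> V" "m \<in> int_lattice" "dist a (k + m) < \<eta>/2"
        using kP unfolding P_def by auto
      have d: "dist (k + m) (k' + m') < \<eta>"
        using dist_triangle_half_r[OF k(4) k'(4)] .
      have "k' + (m' - m) \<in> ball k \<eta>"
        using d by (simp add: dist_norm algebra_simps)
      then have "k' + (m' - m) \<in> V"
        using ball_V[OF k(1,2)] \<open>\<eta> > 0\<close> by auto
      then have "cross2 v (m' - m) = 0"
        using par[OF int_lattice_diff[OF k'(3) k(3)] k'(2)] by blast
      then have "cross2 v k - cross2 v k' = cross2 v ((k + m) - (k' + m'))"
        by (simp add: cross2_diff cross2_add)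
      also have "\<dots> \<le> 2 * norm v * norm ((k + m) - (k' + m'))" by (rule cross2_le)
      also have "\<dots> \<le> 2 * norm v * \<eta>"
        using d by (intro mult_left_mono) (auto simp: dist_norm)
      finally show ?thesis by linarith
    qed
    then show ?thesis by (intro bdd_aboveI2)
  qed simp
  then have "bdd_above (\<Union>a\<in>A. cross2 v ` P a)" using \<open>finite A\<close> by simp
  then obtain M where M: "\<And>a k. a \<in> A \<Longrightarrow> k \<in> P a \<Longrightarrow> cross2 v k \<le> M"
    unfolding bdd_above_def by auto
  have "cross2 v x \<le> M + 2 * norm v * \<eta>" if x: "x \<in> V" for x
  proof -
    obtain k where k: "k \<in> K" "x \<in> ball k \<eta>" using x V in_components_subset by blast
    then have "k \<in> V" using ball_V[OF k(1) x] \<open>\<eta> > 0\<close> centre_in_ball by blast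
    obtain m where m: "m \<in> int_lattice" "k + m \<in> cbox 0 1" by (rule int_lattice_reduce)
    then obtain a where "a \<in> A" "k + m \<in> ball a (\<eta>/2)" using A by blast
    then have "cross2 v k \<le> M" using M \<open>k \<in> V\<close> k m unfolding P_def by blast
    moreover have "cross2 v (x - k) \<le> 2 * norm v * norm (x - k)" by (rule cross2_le)
    moreover have "2 * norm v * norm (x - k) \<le> 2 * norm v * \<eta>"
      using k by (intro mult_left_mono) (auto simp: dist_norm norm_minus_commute)
    ultimately show ?thesis by (simp add: cross2_diff)
  qed
  then show ?thesis by (rule bdd_aboveI2)
qed

text \<open>Otherwise \<open>V\<close> lies below a line parallel to \<open>v\<close>, and the frontier of the complementary
  component above \<open>V\<close> is connected, disjoint from \<open>X\<close> and invariant under translation by \<open>v\<close>; it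
  yields an essential loop outside \<open>X\<close>.\<close>

lemma stabiliser_rank_two:
  fixes X K V :: "(real^2) set"
  assumes "closed X" "K \<subseteq> X" "closed K" "closed (X - K)" and per: "lattice_periodic K"
    and noloop: "\<And>\<gamma>. path \<gamma> \<Longrightarrow> path_image \<gamma> \<subseteq> - X \<Longrightarrow> pathfinish \<gamma> - pathstart \<gamma> \<in> int_lattice
      \<Longrightarrow> pathfinish \<gamma> = pathstart \<gamma>"
    and \<eta>: "\<eta> > 0" "\<And>k x. k \<in> K \<Longrightarrow> x \<in> X - K \<Longrightarrow> 2 * \<eta> \<le> dist k x"
    and V: "V \<in> components (\<Union>k\<in>K. ball k \<eta>)"
    and v: "v \<in> int_lattice" "v \<noteq> 0" "q \<in> V" "q + v \<in> V"
  shows "\<exists>w\<in>int_lattice. q + w \<in> V \<and> cross2 v w \<noteq> 0"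
proof (rule ccontr)
  assume neg: "\<not> ?thesis"
  let ?N = "\<Union>k\<in>K. ball k \<eta>"
  have N_per: "w + x \<in> ?N" if w: "w \<in> int_lattice" and x: "x \<in> ?N" for w x
  proof -
    obtain k where "k \<in> K" "dist k x < \<eta>" using x by auto
    then show ?thesis using lattice_periodicD[OF per w]
      by (intro UN_I[of "k + w"]) (auto simp: dist_norm algebra_simps)
  qed
  have VN: "V \<subseteq> ?N" using V in_components_subset by blast
  have V_shift: "w + z \<in> V" if "w \<in> int_lattice" "x \<in> V" "w + x \<in> V" "z \<in> V" for w x z
  proof (rule component_translate_subset[OF V _ that(2,3,4)])
    show "w + z \<in> ?N" if "z \<in> V" for z using N_per[OF \<open>w \<in> int_lattice\<close>] VN that by blast
  qed
  \<comment> \<open>If \<open>w\<close> moves one point of \<open>V\<close> into \<open>V\<close>,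
    it moves all of \<open>V\<close> into \<open>V\<close>, in particular \<open>q\<close>; the
    negated conclusion then makes \<open>w\<close> parallel to \<open>v\<close>.\<close>
  have par: "cross2 v w = 0" if "w \<in> int_lattice" "x \<in> V" "x + w \<in> V" for x w
    using V_shift[OF that(1,2) _ v(3)] that neg by (auto simp: add.commute)
  have "bdd_above (cross2 v ` V)"
    by (rule strip_component_bounded_above[OF per \<eta>(1) V]) (rule par)
  then obtain M where M: "\<And>x. x \<in> V \<Longrightarrow> cross2 v x \<le> M"
    unfolding bdd_above_def by blast
  have "open ?N" by auto
  then have "open V" using V open_components by blast
  have "connected V" using V in_components_connected by blast
  define H where "H = {x. cross2 v x > M}"
  have "H \<inter> V = {}" using M unfolding H_def by force
  have "connected H" unfolding H_def by (intro convex_connected convex_cross2_gt)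
  obtain h where "h \<in> H"
  proof
    \<comment> \<open>A quarter turn of \<open>v\<close>, so that \<open>cross2 v u\<close> is the
      squared length of \<open>v\<close>.\<close>
    define u :: "real^2" where "u = (\<chi> i. if i = 1 then - v $ 2 else v $ 1)"
    have "v $ 1 \<noteq> 0 \<or> v $ 2 \<noteq> 0" using v(2) by (auto simp: vec_eq_iff forall_2)
    then have pos: "cross2 v u > 0"
      by (simp add: cross2_def u_def sum_power2_gt_zero_iff flip: power2_eq_square)
    have "cross2 v (c *\<^sub>R u) = c * cross2 v u" for c
      by (simp add: cross2_def algebra_simps)
    then show "((M + 1) / cross2 v u) *\<^sub>R u \<in> H" using pos by (simp add: H_def)
  qed
  define T where "T = connected_component_set (- V) h"
  have "h \<in> - V" using \<open>h \<in> H\<close> \<open>H \<inter> V = {}\<close> by blast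
  then have T: "T \<in> components (- V)" by (simp add: T_def componentsI)
  have HT: "H \<subseteq> T" using \<open>h \<in> H\<close> \<open>connected H\<close> \<open>H \<inter> V = {}\<close>
    unfolding T_def by (intro connected_component_maximal) auto
  have v': "- v \<in> int_lattice" using v(1) by (rule int_lattice_minus)
  have V_pm: "v + z \<in> V \<longleftrightarrow> z \<in> V" for z
  proof
    show "v + z \<in> V" if "z \<in> V"
      using V_shift[OF v(1,3) _ that] v(4) by (simp add: add.commute)
    show "z \<in> V" if "v + z \<in> V"
      using V_shift[OF v' v(4) _ that] v(3) by simp
  qed
  \<comment> \<open>Adding multiples of \<open>v\<close> does not change \<open>cross2 v\<close>, so
    the half-plane \<open>H\<close> inside \<open>T\<close> is preserved. The shifted
    \<open>T\<close> therefore meets \<open>T\<close> and still avoids \<open>V\<close>.\<close>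
  have T_step: "c *\<^sub>R v + z \<in> T" if "z \<in> T" "c = 1 \<or> c = -1" for c z
  proof (rule component_translate_subset[OF T _ _ _ that(1)])
    show "c *\<^sub>R v + z \<in> - V" if "z \<in> T" for z
    proof -
      have "z \<notin> V" using that in_components_subset[OF T] by blast
      then show ?thesis using V_pm[of z] V_pm[of "-v + z"] \<open>c = 1 \<or> c = -1\<close> by auto
    qed
    show "h \<in> T" using HT \<open>h \<in> H\<close> by blast
    have "cross2 v (c *\<^sub>R v + h) = cross2 v h" by (simp add: cross2_def algebra_simps)
    then show "c *\<^sub>R v + h \<in> T" using HT \<open>h \<in> H\<close> unfolding H_def by auto
  qed
  have "(\<lambda>z. v + z) ` T = T"
  proof (intro equalityI subsetI)
    show "z \<in> T" if "z \<in> (\<lambda>z. v + z) ` T" for z using that T_step[of _ 1] by auto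
    show "z \<in> (\<lambda>z. v + z) ` T" if "z \<in> T" for z
      using T_step[OF that, of "-1"] by (intro image_eqI[of _ _ "- v + z"]) auto
  qed
  then have fr_shift: "(\<lambda>z. v + z) ` frontier T = frontier T" by (metis frontier_translation)
  have "frontier T \<noteq> {}"
    using HT \<open>h \<in> H\<close> v(3) in_components_subset[OF T] by (auto simp: frontier_eq_empty)
  then obtain r where r: "r \<in> frontier T" by blast
  then have rv: "v + r \<in> frontier T" using fr_shift by blast
  \<comment> \<open>A component of the complement of a connected set has connected frontier; this
    stands in for a boundary curve of \<open>V\<close>.\<close>
  have "connected (frontier T)"
    using connected_frontier_component_complement[OF \<open>connected V\<close> T] .
  \<comment> \<open>A frontier point of \<open>T\<close> is a frontier point of the neighbourhood:
    it lies outside it, hence off \<open>K\<close>, but closer than \<open>2 * \<eta>\<close> to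
    \<open>K\<close>, hence off \<open>X - K\<close>.\<close>
  have fr: "frontier T \<subseteq> - X"
  proof
    fix z assume "z \<in> frontier T"
    then have z: "z \<in> frontier ?N"
      using frontier_of_components_subset[OF T] frontier_of_components_subset[OF V] by auto
    then have "z \<notin> ?N" "z \<in> closure ?N" using \<open>open ?N\<close> by (auto simp: frontier_def interior_open)
    then obtain n where n: "n \<in> ?N" "dist n z < \<eta>" using \<eta>(1) by (meson closure_approachable)
    then obtain k where k: "k \<in> K" "dist k n < \<eta>" by auto
    have "dist k z < 2 * \<eta>" using dist_triangle[of k z n] k n by linarith
    then have "z \<notin> X - K" using \<eta>(2)[OF k(1)] by force
    moreover have "z \<notin> K" using \<open>z \<notin> ?N\<close> \<eta>(1) by auto
    ultimately show "z \<in> - X" by blast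
  qed
  have "connected_component (- X) r (v + r)"
    unfolding connected_component_def using \<open>connected (frontier T)\<close> fr r rv by blast
  then have "path_component (- X) r (v + r)"
    using open_path_connected_component \<open>closed X\<close> by (metis open_Compl)
  then obtain \<gamma> where "path \<gamma>" "path_image \<gamma> \<subseteq> - X" "pathstart \<gamma> = r" "pathfinish \<gamma> = v + r"
    unfolding path_component_def by blast
  then show False using noloop[of \<gamma>] v by simp
qed

subsection \<open>The preimage of a locally connected component\<close>

text \<open>Radius \<open>1/2\<close> keeps two points of the ball less than 1 apart, so they never
  differ by a nonzero lattice vector.\<close>

lemma torus_proj_ball_homeomorphism:
  obtains h where "homeomorphism (ball x (1/2)) (torus_proj ` ball x (1/2)) torus_proj h"
proof (rule homeomorphism_injective_open_map)
  show "continuous_on (ball x (1/2)) torus_proj" by (rule continuous_on_torus_proj)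
  show "inj_on torus_proj (ball x (1/2))"
  proof (rule inj_onI)
    fix y z assume "y \<in> ball x (1/2)" "z \<in> ball x (1/2)" "torus_proj y = torus_proj z"
    then have "norm (y - z) < 1" "y - z \<in> int_lattice"
      using dist_triangle_half_r[of x y 1 z] by (auto simp: torus_proj_eq_iff dist_norm)
    then show "y = z" using int_lattice_small by fastforce
  qed
  show "openin (top_of_set (torus_proj ` ball x (1/2))) (torus_proj ` U)"
    if "openin (top_of_set (ball x (1/2))) U" for U
    using that by (metis image_mono open_ball open_openin_trans open_torus_proj_image openin_open_eq)
qed auto

text \<open>A small connected piece of \<open>C\<close> is carried up by the local inverse of the
  projection; the ball containing its image makes the witness bounded.\<close>

lemma locally_connected_lift:
  assumes "locally connected C" "torus_proj x \<in> C"
  obtains N where "open N" "x \<in> N" "\<And>y. y \<in> N \<Longrightarrow> torus_proj y \<in> C \<Longrightarrow> joined (torus_proj -` C) x y"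
proof -
  obtain h where h: "homeomorphism (ball x (1/2)) (torus_proj ` ball x (1/2)) torus_proj h"
    by (rule torus_proj_ball_homeomorphism)
  have "openin (top_of_set C) (C \<inter> torus_proj ` ball x (1/2))"
    by (simp add: open_torus_proj_image openin_open_Int)
  moreover have "torus_proj x \<in> C \<inter> torus_proj ` ball x (1/2)" using assms(2) by auto
  ultimately obtain u w where uw: "openin (top_of_set C) u" "connected w" "torus_proj x \<in> u" "u \<subseteq> w"
    "w \<subseteq> C \<inter> torus_proj ` ball x (1/2)"
    using assms(1) unfolding locally_def by metis
  obtain O' where O': "open O'" "u = C \<inter> O'" using uw(1) by (auto simp: openin_open)
  show ?thesis
  proof
    show "open (ball x (1/2) \<inter> torus_proj -` O')"
      using O'(1) by (intro open_Int) (auto simp: open_torus_def)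
    show "x \<in> ball x (1/2) \<inter> torus_proj -` O'" using uw(3) O' by auto
    fix y assume y: "y \<in> ball x (1/2) \<inter> torus_proj -` O'" "torus_proj y \<in> C"
    have w: "w \<subseteq> torus_proj ` ball x (1/2)" "w \<subseteq> C" using uw(5) by auto
    have h': "h (torus_proj z) = z" if "z \<in> ball x (1/2)" for z
      using homeomorphism_apply1[OF h that] .
    have "connected (h ` w)"
      using connected_continuous_image[OF continuous_on_subset[OF homeomorphism_cont2[OF h] w(1)] uw(2)] .
    moreover have "h ` w \<subseteq> ball x (1/2)"
      using image_mono[OF w(1), of h] homeomorphism_image2[OF h] by simp
    moreover have "h ` w \<subseteq> torus_proj -` C"
      using homeomorphism_apply2[OF h] w by (auto simp: subset_iff)
    moreover have "z \<in> h ` w" if "torus_proj z \<in> w" "z \<in> ball x (1/2)" for z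
      using image_eqI[of z h "torus_proj z" w] h'[OF that(2)] that(1) by simp
    moreover have "torus_proj x \<in> w" "torus_proj y \<in> w" using uw y O' by auto
    ultimately show "joined (torus_proj -` C) x y"
      unfolding joined_def using y bounded_subset[OF bounded_ball] by (intro exI[of _ "h ` w"]) auto
  qed
qed

text \<open>A Lebesgue number on a compact part of the preimage becomes uniform by lattice
  translations. Two close points share one set \<open>N w\<close> and are joined through
  \<open>w\<close>.\<close>

lemma uniformly_locally_connected_lift:
  assumes "locally connected C" "closed C"
  obtains \<delta> where "\<delta> > 0"
    "\<And>x y. torus_proj x \<in> C \<Longrightarrow> torus_proj y \<in> C \<Longrightarrow> dist x y < \<delta> \<Longrightarrow> joined (torus_proj -` C) x y"
proof -
  let ?E = "torus_proj -` C"
  have "closed ?E" using assms(2) by (simp add: closed_def open_torus_def vimage_Compl flip: vimage_Compl)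
  have "\<exists>N. open N \<and> x \<in> N \<and> (\<forall>y\<in>N \<inter> ?E. joined ?E x y)" if "x \<in> ?E" for x
    using locally_connected_lift[OF assms(1), of x] that by (metis Int_iff vimage_eq)
  then obtain N where N: "\<And>x. x \<in> ?E \<Longrightarrow> open (N x)" "\<And>x. x \<in> ?E \<Longrightarrow> x \<in> N x"
    "\<And>x y. x \<in> ?E \<Longrightarrow> y \<in> N x \<Longrightarrow> y \<in> ?E \<Longrightarrow> joined ?E x y" by (metis Int_iff)
  \<comment> \<open>The radius leaves room for the unit cube, into which every point can be
    translated.\<close>
  define S where "S = ?E \<inter> cball 0 3"
  have "compact S" unfolding S_def using \<open>closed ?E\<close> by (intro closed_Int_compact) auto
  obtain \<delta> where \<delta>: "\<delta> > 0" "\<And>x. x \<in> S \<Longrightarrow> \<exists>G\<in>N ` ?E. ball x \<delta> \<subseteq> G"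
    using Heine_Borel_lemma[OF \<open>compact S\<close>, of "N ` ?E"] N(1,2) unfolding S_def by blast
  show ?thesis
  proof
    show "\<delta> > 0" by fact
    fix x y assume xy: "torus_proj x \<in> C" "torus_proj y \<in> C" "dist x y < \<delta>"
    obtain m where m: "m \<in> int_lattice" "x + m \<in> cbox 0 1" by (rule int_lattice_reduce)
    have "\<bar>(x + m) $ i\<bar> \<le> 1" for i using m(2) by (auto simp: mem_box_cart abs_le_iff)
    from this[of 1] this[of 2] have "norm (x + m) \<le> 3"
      using norm_le_l1_cart[of "x + m"] by (simp add: sum_2)
    then have "x + m \<in> S" using xy(1) m(1) by (auto simp: S_def)
    then obtain w where w: "w \<in> ?E" "ball (x + m) \<delta> \<subseteq> N w" using \<delta>(2) by blast
    have "x + m \<in> N w" "y + m \<in> N w" using w(2) \<delta>(1) xy(3) by (auto simp: dist_norm)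
    then have "joined ?E w (x + m)" "joined ?E w (y + m)"
      using N(3)[OF w(1)] xy m(1) by auto
    then have "joined ?E (x + m) (y + m)" using joined_sym joined_trans by blast
    from joined_translate[OF this lattice_periodic_vimage int_lattice_minus[OF m(1)]]
    show "joined ?E x y" by simp
  qed
qed

text \<open>By the Sura-Bura theorem a compact component has arbitrarily small clopen neighbourhoods
  within the set. Unlike \<open>C\<close>, such a \<open>K\<close> has positive distance from the
  rest of \<open>S\<close> whenever both are nonempty. The characters transport the Euclidean result
  to the torus.\<close>

lemma torus_component_clopen_nbhd:
  fixes S :: "torus set"
  assumes "closed S" "C \<in> components S" "open U" "C \<subseteq> U"
  obtains K where "C \<subseteq> K" "K \<subseteq> S" "K \<subseteq> U" "closed K" "closed (S - K)"
proof -
  define e where "e t = (torus_char 1 t, torus_char 2 t)" for t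
  have cont: "continuous_on A e" for A
    unfolding e_def by (intro continuous_intros continuous_on_torus_char)
  have inj: "inj e"
  proof (rule injI)
    fix s t assume "e s = e t"
    then have "torus_char i s = torus_char i t" for i using exhaust_2[of i] by (auto simp: e_def)
    then show "s = t" by (rule torus_char_eqI)
  qed
  have cpt: "compact (e ` A)" if "closed A" for A
    using that compact_torus cont by (metis compact_Int_closed compact_continuous_image inf_top_left)
  have "closed C" using assms(1,2) closed_components by blast
  have pull: "closed (e -` A)" if "closed A" for A
    using that cont[of UNIV] by (simp add: continuous_on_closed_vimage)
  have hom: "homeomorphism S (e ` S) e (inv e)"
  proof -
    have "continuous_on (e ` S) (inv e)"
    proof (rule continuous_on_subset)
      show "continuous_on (e ` UNIV) (inv e)"
        using continuous_on_inv[OF cont compact_torus, of "inv e"] inj by simp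
    qed auto
    then show ?thesis using inj cont unfolding homeomorphism_def by (auto simp: image_image)
  qed
  have comp: "e ` C \<in> components (e ` S)"
  proof -
    have CS: "C \<subseteq> S" "C \<noteq> {}" "connected C"
      using assms(2) in_components_subset in_components_nonempty in_components_connected by blast+
    have "d = e ` C" if d: "d \<noteq> {}" "d \<subseteq> e ` S" "e ` C \<subseteq> d" "connected d" for d
    proof -
      have "connected (inv e ` d)"
        using hom d(2,4) continuous_on_subset unfolding homeomorphism_def
        by (metis connected_continuous_image)
      moreover have "inv e ` d \<subseteq> S"
        using image_mono[OF d(2), of "inv e"] homeomorphism_image2[OF hom] by simp
      moreover have "C \<subseteq> inv e ` d" using d(3) inj by (metis image_inv_f_f image_mono)
      ultimately have "inv e ` d \<subseteq> C" using components_maximal[OF assms(2)] CS(2) by blast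
      moreover have "d = e ` inv e ` d"
        using hom d(2) unfolding homeomorphism_def image_image by force
      ultimately show ?thesis using d(3) by blast
    qed
    moreover have "connected (e ` C)" using CS cont connected_continuous_image by blast
    ultimately show ?thesis using CS unfolding in_components_maximal by blast
  qed
  have "compact (e ` S)" using assms(1) cpt by blast
  then have lc: "locally compact (e ` S)" by (simp add: closed_imp_locally_compact compact_imp_closed)
  have "closed (e ` (- U))" using assms(3) cpt compact_imp_closed closed_Compl by blast
  then have "open (- e ` (- U))" by (simp add: open_Compl)
  moreover have "e ` C \<subseteq> - e ` (- U)"
    using assms(4) image_Int[OF inj, of C "- U"] by blast
  ultimately obtain K where K: "openin (top_of_set (e ` S)) K" "compact K" "e ` C \<subseteq> K" "K \<subseteq> - e ` (- U)"
    using Sura_Bura_clopen_subset[OF lc comp cpt[OF \<open>closed C\<close>]] by blast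
  have KS: "K \<subseteq> e ` S" using K(1) openin_imp_subset by blast
  show ?thesis
  proof
    show "C \<subseteq> e -` K" using K(3) by blast
    show "e -` K \<subseteq> S"
      using vimage_mono[OF KS, of e] by (simp only: inj_vimage_image_eq[OF inj])
    show "e -` K \<subseteq> U" using K(4) by blast
    show "closed (e -` K)" using K(2) compact_imp_closed pull by blast
    obtain G where "open G" "K = e ` S \<inter> G" using K(1) by (auto simp: openin_open)
    then have "S - e -` K = S \<inter> e -` (- G)" by auto
    then show "closed (S - e -` K)" using assms(1) \<open>open G\<close> pull[of "- G"] by auto
  qed
qed

section \<open>Boundedness of the complementary components\<close>

lemma periodic_nbhd_eq_vimage:
  assumes "lattice_periodic E" "torus_proj x \<in> torus_proj ` (\<Union>e\<in>E. ball e r)"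
  shows "x \<in> (\<Union>e\<in>E. ball e r)"
proof -
  obtain e y where e: "e \<in> E" "dist e y < r" "torus_proj x = torus_proj y" using assms(2) by auto
  then have "e + (x - y) \<in> E" using assms(1) by (simp add: lattice_periodicD torus_proj_eq_iff)
  moreover have "dist (e + (x - y)) x < r" using e(2) by (simp add: dist_norm algebra_simps)
  ultimately show ?thesis by auto
qed

lemma closed_torus_proj_vimage: "closed A \<Longrightarrow> closed (torus_proj -` A)"
  by (simp add: closed_def open_torus_def flip: vimage_Compl)

lemma lifted_sets_separated:
  assumes "closed A" "closed B" "A \<inter> B = {}"
  obtains d where "d > 0" "\<And>x y. torus_proj x \<in> A \<Longrightarrow> torus_proj y \<in> B \<Longrightarrow> d \<le> dist x y"
proof -
  have "compact (cbox 0 1 \<inter> torus_proj -` A)"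
    using assms(1) closed_torus_proj_vimage by (intro compact_Int_closed) auto
  moreover have "(cbox 0 1 \<inter> torus_proj -` A) \<inter> torus_proj -` B = {}" using assms(3) by blast
  ultimately obtain d where d: "d > 0"
    "\<And>x y. x \<in> cbox 0 1 \<inter> torus_proj -` A \<Longrightarrow> y \<in> torus_proj -` B \<Longrightarrow> d \<le> dist x y"
    using separate_compact_closed closed_torus_proj_vimage[OF assms(2)] by metis
  show ?thesis
  proof
    fix x y assume xy: "torus_proj x \<in> A" "torus_proj y \<in> B"
    obtain m where m: "m \<in> int_lattice" "x + m \<in> cbox 0 1" by (rule int_lattice_reduce)
    then show "d \<le> dist x y" using d(2)[of "x + m" "y + m"] xy by simp
  qed fact
qed

lemma lifted_complement_component_bounded:
  fixes S C :: "torus set"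
  assumes "closed S" "fully_essential S" and C: "C \<in> components S" "essential C" "locally connected C"
    and D: "D \<in> components (- (torus_proj -` C))"
  shows "bounded D"
proof -
  let ?E = "torus_proj -` C"
  let ?nb = "\<lambda>A r. (\<Union>a\<in>A. ball a r) :: (real^2) set"
  have "closed C" using assms(1) C(1) closed_components by blast
  obtain \<delta> where \<delta>: "\<delta> > 0"
    "\<And>x y. x \<in> ?E \<Longrightarrow> y \<in> ?E \<Longrightarrow> dist x y < \<delta> \<Longrightarrow> joined ?E x y"
    using uniformly_locally_connected_lift[OF C(3) \<open>closed C\<close>] by (metis vimage_eq)
  have nb: "open (torus_proj ` ?nb ?E r)" "C \<subseteq> torus_proj ` ?nb ?E r" if "r > 0" for r
  proof -
    show "open (torus_proj ` ?nb ?E r)" by (intro open_torus_proj_image) auto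
    show "C \<subseteq> torus_proj ` ?nb ?E r"
    proof
      fix t assume "t \<in> C"
      moreover obtain x where "torus_proj x = t" by (rule torus_proj_surj)
      ultimately show "t \<in> torus_proj ` ?nb ?E r" using that
        by (intro image_eqI[of _ _ x] UN_I[of x]) auto
    qed
  qed
  have "\<delta>/4 > 0" using \<delta>(1) by simp
  obtain K where K: "C \<subseteq> K" "K \<subseteq> S" "K \<subseteq> torus_proj ` ?nb ?E (\<delta>/4)" "closed K" "closed (S - K)"
    by (rule torus_component_clopen_nbhd[OF assms(1) C(1) nb[OF \<open>\<delta>/4 > 0\<close>]])
  let ?K = "torus_proj -` K" and ?X = "torus_proj -` S"
  have K_near: "?K \<subseteq> ?nb ?E (\<delta>/4)"
  proof
    fix x assume "x \<in> ?K"
    then have "torus_proj x \<in> torus_proj ` ?nb ?E (\<delta>/4)" using K(3) by (auto simp only: vimage_eq subset_iff)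
    then show "x \<in> ?nb ?E (\<delta>/4)" by (rule periodic_nbhd_eq_vimage[OF lattice_periodic_vimage])
  qed
  obtain d where d: "d > 0"
    "\<And>x y. torus_proj x \<in> K \<Longrightarrow> torus_proj y \<in> S - K \<Longrightarrow> d \<le> dist x y"
    by (rule lifted_sets_separated[OF K(4,5)]) auto
  \<comment> \<open>The bound \<open>d/2\<close> keeps the frontier of the neighbourhood of
    \<open>?K\<close> off \<open>?X\<close>; the bound \<open>\<delta>/4\<close>, added to the
    \<open>\<delta>/4\<close> from \<open>K_near\<close>, keeps that neighbourhood within
    \<open>\<delta>/2\<close> of \<open>?E\<close>.\<close>
  define \<eta> where "\<eta> = min (d/2) (\<delta>/4)"
  have \<eta>: "\<eta> > 0" "2 * \<eta> \<le> d" "\<eta> \<le> \<delta>/4" using d(1) \<delta>(1) by (auto simp: \<eta>_def)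
  have "\<not> inessential_open (torus_proj ` ?nb ?E \<eta>)"
    using C(2) nb[OF \<eta>(1)] unfolding inessential_def by blast
  then obtain \<gamma> where \<gamma>: "path \<gamma>" "\<And>t. t \<in> {0..1} \<Longrightarrow> torus_proj (\<gamma> t) \<in> torus_proj ` ?nb ?E \<eta>"
    "pathfinish \<gamma> - pathstart \<gamma> \<in> int_lattice" "pathfinish \<gamma> \<noteq> pathstart \<gamma>"
    by (rule not_inessential_openE) blast
  have \<gamma>_near: "path_image \<gamma> \<subseteq> ?nb ?E \<eta>"
    using periodic_nbhd_eq_vimage[OF lattice_periodic_vimage \<gamma>(2)] unfolding path_image_def by blast
  define q v where "q = pathstart \<gamma>" and "v = pathfinish \<gamma> - pathstart \<gamma>"
  have qv: "q + v = pathfinish \<gamma>" by (simp add: q_def v_def)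
  have EK: "?nb ?E \<eta> \<subseteq> ?nb ?K \<eta>" using K(1) by auto
  \<comment> \<open>The loop runs near \<open>?E\<close>, but its component is taken near
    \<open>?K\<close>, because only \<open>K\<close> is isolated from the rest of
    \<open>S\<close>.\<close>
  define V where "V = connected_component_set (?nb ?K \<eta>) q"
  have "q \<in> path_image \<gamma>" unfolding q_def by (rule pathstart_in_path_image)
  then have V: "V \<in> components (?nb ?K \<eta>)"
    using \<gamma>_near EK unfolding V_def by (intro componentsI) blast
  have "path_image \<gamma> \<subseteq> V" unfolding V_def
    using \<gamma>_near EK \<open>q \<in> path_image \<gamma>\<close>
    by (intro connected_component_maximal connected_path_image \<gamma>(1)) blast+
  then have qV: "q \<in> V" "q + v \<in> V" unfolding qv by (auto simp: q_def)
  obtain U where U: "- S \<subseteq> U" "inessential_open U"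
    using assms(2) unfolding fully_essential_def inessential_def by blast
  have v: "v \<in> int_lattice" "v \<noteq> 0" using \<gamma> by (auto simp: v_def)
  have "\<exists>w\<in>int_lattice. q + w \<in> V \<and> cross2 v w \<noteq> 0"
  proof (rule stabiliser_rank_two[OF _ _ _ _ lattice_periodic_vimage _ \<eta>(1) _ V v qV])
    show "closed ?X" "closed ?K" using assms(1) K(4) closed_torus_proj_vimage by blast+
    show "closed (?X - ?K)"
      using closed_torus_proj_vimage[OF K(5)] by (simp only: vimage_Diff)
    show "?K \<subseteq> ?X" using K(2) by blast
    \<comment> \<open>Full essentiality enters here: a loop off \<open>S\<close> lies in the
      inessential set \<open>U\<close>, so its lift closes up.\<close>
    show "pathfinish c = pathstart c"
      if c: "path c" "path_image c \<subseteq> - ?X" "pathfinish c - pathstart c \<in> int_lattice" for c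
    proof (rule inessential_open_lift[OF U(2) c(1) _ c(3)])
      fix t :: real assume "t \<in> {0..1}"
      then have "c t \<in> path_image c" by (auto simp: path_image_def)
      then show "torus_proj (c t) \<in> U" using c(2) U(1) by blast
    qed
    show "2 * \<eta> \<le> dist k x" if "k \<in> ?K" "x \<in> ?X - ?K" for k x
      using d(2)[of k x] that \<eta>(2) by force
  qed
  then obtain w where w: "w \<in> int_lattice" "q + w \<in> V" "cross2 v w \<noteq> 0" by blast
  obtain e where e: "e \<in> ?E" "dist e q < \<eta>" using \<gamma>_near \<open>q \<in> path_image \<gamma>\<close> by auto
  have V_near: "V \<subseteq> ?nb ?E (\<delta>/2)"
  proof
    fix x assume "x \<in> V"
    then obtain k where "k \<in> ?K" "dist k x < \<eta>" using V in_components_subset by fastforce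
    then obtain c where "c \<in> ?E" "dist c k < \<delta>/4" "dist k x < \<delta>/4" using K_near \<eta>(3) by fastforce
    then show "x \<in> ?nb ?E (\<delta>/2)" using dist_triangle_less_add[of c k "\<delta>/4" x "\<delta>/4"]
      by (auto simp: dist_commute)
  qed
  \<comment> \<open>Every lattice vector that keeps \<open>q\<close> in \<open>V\<close> is realised
    inside \<open>?E\<close>, starting from the point \<open>e\<close> near
    \<open>q\<close>.\<close>
  have jo: "joined ?E e (e + m)" if "m \<in> int_lattice" "q + m \<in> V" for m
  proof (rule joined_if_near_connected[OF \<delta>(2) _ V_near qV(1) that(2) e(1)])
    show "connected V" using V in_components_connected by blast
    show "dist e q < \<delta>/2" "dist (e + m) (q + m) < \<delta>/2" using e(2) \<eta>(3) \<delta>(1) by auto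
    show "e + m \<in> ?E" using e(1) that(1) by simp
  qed auto
  have "joined ?E e (e + axis j \<bar>cross2 v w\<bar>)" for j
    using joined_axis_translates[OF lattice_periodic_vimage v(1) jo[OF v(1) qV(2)] w(1) jo[OF w(1,2)] w(3)] .
  moreover have "cross2 v w \<in> \<int>" using v(1) w(1) by (auto simp: cross2_def int_lattice_def)
  ultimately show ?thesis
    using closed_torus_proj_vimage[OF \<open>closed C\<close>] w(3) D
    by (intro bounded_component_of_grid_complement[OF _ lattice_periodic_vimage[of C], of "\<bar>cross2 v w\<bar>" e]) auto
qed

subsection \<open>Dynamics\<close>

text \<open>The segment from \<open>z\<close> to \<open>z + m\<close> projects to a loop that the
  homotopy from \<open>f\<close> to the identity links freely to its image, so both have
  displacement \<open>m\<close>.\<close>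

lemma lift_of_translate:
  assumes "homotopic_with_canon (\<lambda>_. True) UNIV UNIV f id" "lift_of f F" "m \<in> int_lattice"
  shows "F (z + m) = F z + m"
proof -
  define \<gamma> where "\<gamma> t = z + t *\<^sub>R m" for t :: real
  have p: "path \<gamma>" unfolding \<gamma>_def path_def by (intro continuous_intros)
  have F: "continuous_on UNIV F" "\<And>z. torus_proj (F z) = f (torus_proj z)"
    using assms(2) by (auto simp: lift_of_def)
  have pF: "path (F \<circ> \<gamma>)" using p F(1) continuous_on_subset by (blast intro: path_continuous_image)
  have pp: "path (torus_proj \<circ> \<gamma>)" using p continuous_on_torus_proj by (rule path_continuous_image)
  obtain h where h: "continuous_on ({0..1::real} \<times> UNIV) h" "\<And>x. h (0, x) = f x" "\<And>x. h (1, x) = x"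
  proof -
    obtain h where "continuous_map (prod_topology (top_of_set {0..1::real}) euclidean) euclidean h"
      "\<forall>x. h (0::real, x) = f x" "\<forall>x. h (1, x) = x"
      using assms(1) by (auto simp: homotopic_with_def)
    moreover have "prod_topology (top_of_set {0..1}) (euclidean :: torus topology) = top_of_set ({0..1::real} \<times> UNIV)"
      using prod_topology_subtopology_eu[of "{0..1::real}" "UNIV :: torus set"] by simp
    ultimately show ?thesis using that[of h] by simp
  qed
  have loop: "torus_proj (\<gamma> 0) = torus_proj (\<gamma> 1)" using assms(3) by (simp add: \<gamma>_def)
  have "homotopic_loops UNIV (torus_proj \<circ> (F \<circ> \<gamma>)) (torus_proj \<circ> \<gamma>)"
    unfolding homotopic_loops
  proof (intro exI[of _ "\<lambda>x. h (fst x, torus_proj (\<gamma> (snd x)))"] conjI ballI)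
    show "continuous_on ({0..1} \<times> {0..1}) (\<lambda>x. h (fst x, torus_proj (\<gamma> (snd x))))"
    proof (rule continuous_on_compose2[OF h(1)])
      show "continuous_on ({0..1} \<times> {0..1}) (\<lambda>x :: real \<times> real. (fst x, torus_proj (\<gamma> (snd x))))"
        using pp unfolding path_def
        by (intro continuous_intros continuous_on_compose2[of "{0..1}" "torus_proj \<circ> \<gamma>" _ snd, unfolded o_def]) auto
    qed auto
  qed (use h F(2) loop in \<open>auto simp: pathfinish_def pathstart_def\<close>)
  from homotopic_torus_loops_displacement[OF this pF p]
  show ?thesis by (simp add: pathfinish_def pathstart_def \<gamma>_def algebra_simps)
qed

lemma funpow_translate:
  assumes "\<And>z. F (z + m) = F z + m"
  shows "(F ^^ n) (z + m) = (F ^^ n) z + (m :: 'a::plus)"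
  by (induction n) (simp_all add: assms)

text \<open>A drift of \<open>v\<close> per \<open>n\<close> iterates, up to bounded error, makes
  \<open>v /\<^sub>R real n\<close> a rotation vector, realised by the constant sequence
  \<open>z\<close>.\<close>

lemma rotation_set_zero_displacement:
  assumes "rotation_set F = {0}" "n > 0"
    and B: "\<And>k. norm ((F ^^ (k * n)) z - z - real k *\<^sub>R v) \<le> B"
  shows "v = 0"
proof -
  let ?g = "\<lambda>k. ((F ^^ (Suc k * n)) z - z) /\<^sub>R real (Suc k * n)"
  have "(\<lambda>k. ?g k - v /\<^sub>R real n) \<longlonglongrightarrow> 0"
  proof (rule Lim_null_comparison)
    show "\<forall>\<^sub>F k in sequentially. norm (?g k - v /\<^sub>R real n) \<le> B * inverse (real (Suc k))"
    proof (intro always_eventually allI)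
      fix k
      have "?g k - v /\<^sub>R real n = ((F ^^ (Suc k * n)) z - z - real (Suc k) *\<^sub>R v) /\<^sub>R real (Suc k * n)"
        using assms(2) by (simp add: scaleR_diff_right del: funpow.simps mult_Suc of_nat_Suc)
      then have "norm (?g k - v /\<^sub>R real n) = norm ((F ^^ (Suc k * n)) z - z - real (Suc k) *\<^sub>R v) * inverse (real (Suc k * n))"
        by (simp only: norm_scaleR abs_inverse abs_of_nat mult.commute)
      also have "\<dots> \<le> B * inverse (real (Suc k))"
      proof (rule mult_mono[OF B])
        have "real (Suc k) \<le> real (Suc k * n)" using assms(2) by (intro of_nat_mono) (cases n; simp)
        then show "inverse (real (Suc k * n)) \<le> inverse (real (Suc k))" by (intro le_imp_inverse_le) auto
        show "0 \<le> B" using B[of 0] norm_ge_zero order_trans by blast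
      qed auto
      finally show "norm (?g k - v /\<^sub>R real n) \<le> B * inverse (real (Suc k))" .
    qed
    show "(\<lambda>k. B * inverse (real (Suc k))) \<longlonglongrightarrow> 0"
      using tendsto_mult_left[OF LIMSEQ_inverse_real_of_nat, of B] by (simp only: mult_zero_right)
  qed
  then have "?g \<longlonglongrightarrow> v /\<^sub>R real n" by (rule LIM_zero_cancel)
  moreover have "filterlim (\<lambda>k. Suc k * n) at_top sequentially"
  proof (rule filterlim_at_top_mono[OF filterlim_ident])
    show "\<forall>\<^sub>F k in sequentially. k \<le> Suc k * n"
      using assms(2) by (intro always_eventually allI) (cases n; simp)
  qed
  ultimately have "v /\<^sub>R real n \<in> rotation_set F" unfolding rotation_set_def
    by (intro CollectI exI[of _ "\<lambda>_. z"] exI[of _ "\<lambda>k. Suc k * n"]) blast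
  then show ?thesis using assms(1,2) by simp
qed

text \<open>Without a return, the preimages of \<open>U\<close> under the iterates would be pairwise
  disjoint with equal positive measure, and finitely many of them would exceed total mass 1.\<close>

lemma measure_preserving_recurrence:
  assumes "prob_space \<mu>" "sets \<mu> = sets (borel :: 'a::topological_space measure)" "distr \<mu> \<mu> f = \<mu>"
    and f: "continuous_on UNIV f" and U: "open U" "emeasure \<mu> U > 0"
  shows "\<exists>n>0. \<exists>x\<in>U. (f ^^ n) x \<in> U"
proof (rule ccontr)
  assume neg: "\<not> ?thesis"
  interpret prob_space \<mu> by fact
  have sp: "space \<mu> = UNIV" using sets_eq_imp_space_eq[OF assms(2)] by simp
  have fm: "f \<in> measurable \<mu> \<mu>"
    using borel_measurable_continuous_onI[OF f] measurable_cong_sets[OF assms(2) assms(2)] by blast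
  have om: "open A \<Longrightarrow> A \<in> sets \<mu>" for A using assms(2) by auto
  define A where "A k = (f ^^ k) -` U" for k
  have A: "open (A k) \<and> measure \<mu> (A k) = measure \<mu> U" for k
  proof (induction k)
    case 0 show ?case using U(1) by (simp add: A_def)
  next
    case (Suc k)
    have eq: "A (Suc k) = f -` A k" by (simp only: A_def funpow_Suc_right vimage_comp)
    have "open (A (Suc k))"
      using Suc f continuous_on_open_vimage[of UNIV f] by (simp add: eq)
    moreover have "measure \<mu> (A k) = measure \<mu> (A (Suc k))"
      using measure_distr[OF fm om, of "A k"] Suc assms(3) sp by (simp add: eq)
    ultimately show ?case using Suc by simp
  qed
  have disj: "A j \<inter> A k = {}" if "j < k" for j k
  proof -
    have "(f ^^ k) x = (f ^^ (k - j)) ((f ^^ j) x)" for x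
      using that by (metis add_diff_cancel_left' comp_apply funpow_add le_add_diff_inverse2 less_imp_le_nat)
    moreover have "k - j > 0" using that by simp
    ultimately have "(f ^^ k) x \<notin> U" if "(f ^^ j) x \<in> U" for x using neg that by metis
    then show ?thesis unfolding A_def by blast
  qed
  have "disjoint_family_on A {..<n}" for n
    unfolding disjoint_family_on_def using disj by (metis inf_commute linorder_neqE_nat)
  then have "measure \<mu> (\<Union>k<n. A k) = (\<Sum>k<n. measure \<mu> (A k))" for n
    using A om by (intro finite_measure_finite_Union) auto
  then have "real n * measure \<mu> U \<le> 1" for n
    using prob_le_1[of "\<Union>k<n. A k"] A by simp
  moreover have "measure \<mu> U > 0" using U(2) by (simp add: emeasure_eq_measure)
  ultimately show False by (metis ex_less_of_nat_mult linorder_not_less)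
qed

lemma bounded_orbit_if_invariant:
  assumes "inj F" "F ` B = B" "bounded B" "z \<in> B"
  shows "bounded (range (\<lambda>n. int_iterate F n z))"
proof -
  have "inv F ` B = B" using assms(1,2) by (metis image_inv_f_f)
  then have "(F ^^ n) z \<in> B" "(inv F ^^ n) z \<in> B" for n
    using assms(2,4) by (induction n) (simp, simp, force, force)
  then have "range (\<lambda>n. int_iterate F n z) \<subseteq> B" by (auto simp: int_iterate_def)
  then show ?thesis using assms(3) bounded_subset by blast
qed

text \<open>\<open>G\<close> preserves the complement of \<open>E\<close>, so the image of
  \<open>D\<close> shifted back by \<open>v\<close> is connected, avoids \<open>E\<close> and meets
  \<open>D\<close>; maximality puts it inside \<open>D\<close>. The inverse \<open>G'\<close> gives
  the other inclusion.\<close>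

lemma component_image_eq_translate:
  fixes E D :: "'a::euclidean_space set"
  assumes "homeomorphism UNIV UNIV G G'" "\<And>z. z \<in> E \<Longrightarrow> G z = z"
    and E: "\<And>z. z + v \<in> E \<longleftrightarrow> z \<in> E" and D: "D \<in> components (- E)" and z: "z \<in> D" "G z - v \<in> D"
  shows "G ` D = (\<lambda>x. v + x) ` D"
proof -
  have G: "continuous_on UNIV G" "continuous_on UNIV G'" "\<And>z. G' (G z) = z" "\<And>z. G (G' z) = z"
    using assms(1) by (auto simp: homeomorphism_def)
  have DE: "D \<subseteq> - E" "connected D" using D in_components_subset in_components_connected by blast+
  have GE: "G x \<in> E \<longleftrightarrow> x \<in> E" for x using assms(2) G(3) by metis
  have "(\<lambda>x. - v + x) ` G ` D \<subseteq> D"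
  proof (rule components_maximal[OF D])
    show "connected ((\<lambda>x. - v + x) ` G ` D)"
      using G(1) DE(2) continuous_on_subset
      by (intro connected_translate connected_continuous_image) blast+
    show "(\<lambda>x. - v + x) ` G ` D \<subseteq> - E"
      using DE(1) GE E[of "_ - v"] by auto
    show "D \<inter> (\<lambda>x. - v + x) ` G ` D \<noteq> {}" using z by auto
  qed
  moreover have "G' ` (\<lambda>x. v + x) ` D \<subseteq> D"
  proof (rule components_maximal[OF D])
    show "connected (G' ` (\<lambda>x. v + x) ` D)"
      using G(2) DE(2) continuous_on_subset
      by (intro connected_translate connected_continuous_image) blast+
    show "G' ` (\<lambda>x. v + x) ` D \<subseteq> - E"
      using DE(1) GE G(4) E by (auto simp: add.commute) (metis ComplD add.commute subsetD)
    have "z = G' (v + (G z - v))" using G(3) by simp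
    then show "D \<inter> G' ` (\<lambda>x. v + x) ` D \<noteq> {}" using z by blast
  qed
  ultimately show ?thesis
    using G(4) by (auto simp: image_subset_iff image_iff) (metis add_diff_cancel_left' diff_add_cancel uminus_add_conv_diff add.commute)+
qed

theorem proposition3:
  fixes f :: "torus \<Rightarrow> torus"
    and F :: "real^2 \<Rightarrow> real^2"
    and \<mu> :: "torus measure"
    and C :: "torus set"
  assumes "\<exists>g. homeomorphism UNIV UNIV f g"
    and "irrotational f"
    and "prob_space \<mu>"
    and "sets \<mu> = sets borel"
    and "full_support \<mu>"
    and "distr \<mu> \<mu> f = \<mu>"
    and "irrotational_lift f F"
    and "fully_essential (Fix f)"
    and "\<not> all_orbits_bounded F"
    and "\<not> bounded_in_integer_direction F"
    and "C \<in> components (Fix f)"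
    and "essential C"
  shows "\<not> locally connected C"
proof
  assume lc: "locally connected C"
  let ?E = "torus_proj -` C"
  obtain g where g: "homeomorphism UNIV UNIV f g" using assms(1) by blast
  then have f: "continuous_on UNIV f" "inj f" "surj f"
    by (auto simp: homeomorphism_def intro: inj_on_inverseI)
  have F: "continuous_on UNIV F" "\<And>z. torus_proj (F z) = f (torus_proj z)"
    and lift: "lift_of f F" and rot: "rotation_set F = {0}"
    using assms(7) by (auto simp: irrotational_lift_def lift_of_def)
  have per: "F (z + m) = F z + m" if "m \<in> int_lattice" for z m
    using lift_of_translate[OF _ lift that] assms(2) by (simp add: irrotational_def)
  have per_pow: "(F ^^ n) (z + m) = (F ^^ n) z + m" if "m \<in> int_lattice" for n z m
    using funpow_translate per[OF that] by blast
  have proj_pow: "torus_proj ((F ^^ n) z) = (f ^^ n) (torus_proj z)" for n z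
    by (induction n) (simp_all add: F(2))
  have "inj F"
  proof (rule injI)
    fix y z assume yz: "F y = F z"
    then have "f (torus_proj y) = f (torus_proj z)" by (simp flip: F(2))
    then have "y - z \<in> int_lattice" using f(2) by (simp add: inj_eq torus_proj_eq_iff)
    then show "y = z" using per[of "y - z" z] yz by simp
  qed
  have "surj F"
  proof (rule surjI)
    fix w
    show "F (SOME z. F z = w) = w"
    proof (rule someI_ex)
      obtain z where "torus_proj w = f (torus_proj z)" using f(3) torus_proj_surj by (metis surjD)
      then have m: "w - F z \<in> int_lattice" by (simp flip: F(2) torus_proj_eq_iff)
      then show "\<exists>z. F z = w" using per[OF m, of z] by (intro exI[of _ "z + (w - F z)"]) simp
    qed
  qed
  \<comment> \<open>Over a fixed point of \<open>f\<close> the lift moves \<open>z\<close> by a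
    lattice vector \<open>v\<close>, and periodicity makes the orbit drift exactly linearly, so
    \<open>v\<close> is a rotation vector and vanishes.\<close>
  have fix_iff: "F z = z \<longleftrightarrow> torus_proj z \<in> Fix f" for z
  proof
    assume "torus_proj z \<in> Fix f"
    then have v: "F z - z \<in> int_lattice" by (simp add: Fix_def F(2) flip: torus_proj_eq_iff)
    define v where "v = F z - z"
    have "(F ^^ k) z = z + real k *\<^sub>R v" for k
    proof (induction k)
      case (Suc k)
      have "F (z + real k *\<^sub>R v) = F z + real k *\<^sub>R v"
        using v by (intro per int_lattice_scale) (auto simp: v_def)
      moreover have "F z = z + v" by (simp add: v_def)
      ultimately show ?case by (simp only: funpow.simps o_apply Suc) (simp add: algebra_simps)
    qed simp
    then have "v = 0" using rotation_set_zero_displacement[OF rot, of 1 z v 0] by simp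
    then show "F z = z" by (simp add: v_def)
  qed (simp add: Fix_def flip: F(2))
  have "closed (Fix f)"
  proof -
    have "torus_proj -` Fix f = {z. F z = z}" using fix_iff by auto
    moreover have "closed {z. F z = z}" by (intro closed_Collect_eq F(1) continuous_on_id)
    ultimately show ?thesis by (simp add: closed_def open_torus_def vimage_Compl)
  qed
  then have "closed C" using assms(11) closed_components by blast
  then have "open (- ?E)" using closed_torus_proj_vimage by blast
  have E_fixed: "F z = z" if "z \<in> ?E" for z
    using that assms(11) in_components_subset fix_iff by blast
  have "bounded (range (\<lambda>n. int_iterate F n z))" for z
  proof (cases "z \<in> ?E")
    case True
    then show ?thesis
      using E_fixed by (intro bounded_orbit_if_invariant[OF \<open>inj F\<close>, of "{z}"]) auto
  next
    case False
    define D where "D = connected_component_set (- ?E) z"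
    have D: "D \<in> components (- ?E)" using False by (auto simp: D_def intro: componentsI)
    have "z \<in> D" using False by (simp add: D_def)
    have "bounded D"
      by (rule lifted_complement_component_bounded[OF \<open>closed (Fix f)\<close> assms(8,11,12) lc D])
    have "open D" using D \<open>open (- ?E)\<close> open_components by blast
    then have "emeasure \<mu> (torus_proj ` D) > 0"
      using assms(5) \<open>z \<in> D\<close> open_torus_proj_image unfolding full_support_def by blast
    then obtain n where n: "n > 0" and "\<exists>x\<in>torus_proj ` D. (f ^^ n) x \<in> torus_proj ` D"
      using measure_preserving_recurrence[OF assms(3,4,6) f(1) open_torus_proj_image[OF \<open>open D\<close>]] by blast
    then obtain y y' where y: "y \<in> D" "y' \<in> D" "(f ^^ n) (torus_proj y) = torus_proj y'" by auto
    \<comment> \<open>A return on the torus only says that \<open>(F ^^ n) y\<close> lies in a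
      lattice translate of \<open>D\<close>; this is the translation.\<close>
    define v where "v = (F ^^ n) y - y'"
    have v: "v \<in> int_lattice"
      using y(3) by (simp add: v_def proj_pow flip: torus_proj_eq_iff)
    have cont: "continuous_on S (F ^^ k)" for S k
    proof (induction k arbitrary: S)
      case (Suc k)
      show ?case
        using continuous_on_compose[OF Suc[of S] continuous_on_subset[OF F(1)]] by simp
    qed (simp add: id_def)
    have "inj (F ^^ n)" "surj (F ^^ n)"
      using \<open>inj F\<close> \<open>surj F\<close> by (simp_all add: inj_fn surj_fn)
    then obtain G where "homeomorphism UNIV UNIV (F ^^ n) G"
      using invariance_of_domain_homeomorphism[of UNIV "F ^^ n"] cont by auto
    then have image: "(F ^^ n) ` D = (\<lambda>x. v + x) ` D"
    proof (rule component_image_eq_translate[OF _ _ _ D y(1)])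
      show "(F ^^ n) z = z" if "z \<in> ?E" for z
        using E_fixed[OF that] by (induction n) simp_all
      show "z + v \<in> ?E \<longleftrightarrow> z \<in> ?E" for z using v by simp
      show "(F ^^ n) y - v \<in> D" using y(2) by (simp add: v_def)
    qed
    \<comment> \<open>The iterate \<open>F ^^ n\<close> maps \<open>D\<close> onto
      \<open>v + D\<close> and commutes with lattice translations, so the drift accumulates linearly
      with an error bounded by the size of \<open>D\<close>.\<close>
    have drift: "\<exists>d\<in>D. (F ^^ (k * n)) z = d + real k *\<^sub>R v" for k
    proof (induction k)
      case 0 show ?case using \<open>z \<in> D\<close> by simp
    next
      case (Suc k)
      then obtain d where d: "d \<in> D" "(F ^^ (k * n)) z = d + real k *\<^sub>R v" by blast
      obtain d' where d': "d' \<in> D" "(F ^^ n) d = v + d'" using image d(1) by blast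
      have "(F ^^ (Suc k * n)) z = (F ^^ n) (d + real k *\<^sub>R v)"
        using d(2) by (simp add: funpow_add)
      also have "\<dots> = d' + real (Suc k) *\<^sub>R v"
        using per_pow[OF int_lattice_scale[OF v, of "real k"]] d'(2) by (simp add: algebra_simps)
      finally show ?case using d'(1) by blast
    qed
    obtain B where B: "\<And>x. x \<in> D \<Longrightarrow> norm x \<le> B" using \<open>bounded D\<close> by (auto simp: bounded_iff)
    have "norm ((F ^^ (k * n)) z - z - real k *\<^sub>R v) \<le> B + norm z" for k
    proof -
      obtain d where "d \<in> D" "(F ^^ (k * n)) z = d + real k *\<^sub>R v" using drift by blast
      then show ?thesis using norm_triangle_ineq4[of d z] B[of d] by simp
    qed
    then have "v = 0" by (rule rotation_set_zero_displacement[OF rot n])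
    then have D_inv: "(F ^^ n) ` D = D" using image by simp
    define O' where "O' = (\<Union>k<n. (F ^^ k) ` D)"
    have "F ` O' = (\<Union>k<n. (F ^^ Suc k) ` D)" by (auto simp: O'_def)
    also have "\<dots> = (\<Union>k\<in>Suc ` {..<n}. (F ^^ k) ` D)" by blast
    also have "\<dots> = O'"
    proof -
      have "Suc ` {..<n} = {1..n}" by (simp add: image_Suc_lessThan)
      moreover have "(F ^^ n) ` D = (F ^^ 0) ` D" using D_inv by simp
      moreover have "{1..n} = insert n {1..<n}" "{..<n} = insert 0 {1..<n}" using n by auto
      ultimately show ?thesis by (simp only: O'_def UN_insert)
    qed
    finally have "F ` O' = O'" .
    moreover have "bounded O'"
    proof -
      have "bounded ((F ^^ k) ` D)" for k
      proof (rule bounded_subset)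
        show "bounded ((F ^^ k) ` closure D)"
          using \<open>bounded D\<close> cont by (intro compact_imp_bounded compact_continuous_image) auto
      qed (use closure_subset in blast)
      then show ?thesis by (auto simp: O'_def)
    qed
    moreover have "z \<in> O'" using \<open>z \<in> D\<close> n by (force simp: O'_def)
    ultimately show ?thesis by (intro bounded_orbit_if_invariant[OF \<open>inj F\<close>])
  qed
  then show False using assms(9) by (simp add: all_orbits_bounded_def)
qed

end
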